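(* Let $K=\mathbf{k}[Y|R]=\mathbf{k}[Y]/Id(R)$ be an arbitrary commutative $\mathbf{k}$-algebra, $R\subseteq\mathbf{k}[Y]$. Let $S$ be a Gröbner–Shirshov basis in $Lie_{\mathbf{k}[Y]}(X)$ such that every $s\in S$ is $\mathbf{k}[Y]$-monic. Then the Lie $K$-algebra $\mathcal{L}=Lie_K(X|S)$ is embeddable into its universal enveloping algebra $U_K(\mathcal{L})=K\langle X|S^{(-)}\rangle$, i.e., the canonical $K$-linear map $\mathcal{L}\to U_K(\mathcal{L})$ induced by $x\mapsto x$ is injective.
   Context: Let $\mathbf{k}$ be a field and $X$, $Y$ well-ordered sets. $X^*$ is the free monoid on $X$. Lex ordering $>$ on $X^*$: $1>t$ for every $t\neq1$, and for $u=xu'$, $v=x'v'$ ($x,x'\in X$), $u>v$ iff $x>x'$, or $x=x'$ and $u'>v'$. Deg-lex $\succ_X$: longer words are bigger, equal lengths compared by lex. $w\ne1$ is an ALSW if $w>vu$ for all factorizations $w=uv$, $u,v\neq1$; $ALSW(X)$ is their set. Every $c\in X^*$ factors uniquely as $c=c_1\cdots c_n$, $c_i\in ALSW(X)$, $c_1\le\cdots\le c_n$. Each $w\in ALSW(X)$ has a standard bracketing $[w]$: $[w]=w$ if $|w|=1$, else $[w]=[[u],[v]]$ with $v$ the longest proper ALSW suffix of $w$. $[Y]$ is the free commutative monoid on $Y$ with deg-lex order $\succ_Y$; $\mathbf{k}[Y]\langle X\rangle$ is the free associative $\mathbf{k}[Y]$-algebra on $X$ with $\mathbf{k}$-basis $[Y]X^*=\{u^Yu^X\}$;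 $Lie_{\mathbf{k}[Y]}(X)$ is its $\mathbf{k}[Y]$-Lie subalgebra generated by $X$ under $[p,q]=pq-qp$. Order $[Y]X^*$ by $u\succ v$ iff $u^X\succ_Xv^X$, or $u^X=v^X$ and $u^Y\succ_Y v^Y$. For nonzero $f$, $\bar f=\bar f^Y\bar f^X$ is the $\succ$-largest element of $[Y]X^*$ occurring in $f$; $f$ is $\mathbf{k}$-monic if its coefficient is $1$. Writing $f\in Lie_{\mathbf{k}[Y]}(X)$ uniquely as $f=\sum_i f_i(Y)[u_i]$ with $0\ne f_i\in\mathbf{k}[Y]$, distinct $u_i\in ALSW(X)$, $u_1\succ_Xu_2\succ_X\cdots$, $f$ is $\mathbf{k}[Y]$-monic if $f_1=1$. Special bracketing: if $u\in ALSW(X)$, $a,b\in X^*$, $aub\in ALSW(X)$, then $[aub]=[a[uc]d]$ with $b=cd$ and $[uc]$ the standard bracketing of $uc$ occurring as a sub-bracket; with $c=c_1\cdots c_n$ the nondecreasing ALSW factorization, $[aub]_u$ is obtained by replacing $[uc]$ with $[\cdots[[u,[c_1]],[c_2]],\dots,[c_n]]$. For $\mathbf{k}$-monic $s$ and $a,b$ with $a\bar s^Xb\in ALSW(X)$, the normal $s$-word $[asb]_{\bar s}$ is obtained from $[a\bar s^Xb]_{\bar s^X}$ by replacing the sub-bracket $[\bar s^X]$ by $s$. Compositions of $\mathbf{k}$-monic $f,g$, with $L=\mathrm{lcm}(\bar f^Y,\bar g^Y)$: (1) if $\bar f^X=a\bar g^Xb$, $C_1\langle f,g\rangle_w=\frac{L}{\bar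 f^Y}f-\frac{L}{\bar g^Y}[agb]_{\bar g}$, $w=L\bar f^X$; (2) if $\bar f^X=aa_0$, $\bar g^X=a_0b$, $a,b,a_0\neq1$, $C_2\langle f,g\rangle_w=\frac{L}{\bar f^Y}[fb]_{\bar f}-\frac{L}{\bar g^Y}[ag]_{\bar g}$, $w=L\bar f^Xb$; (3) if $\gcd(\bar f^Y,\bar g^Y)\neq1$, for any $a,b,c$ with $a\bar f^Xb\bar g^Xc\in ALSW(X)$, $C_3\langle f,g\rangle_w=\frac{L}{\bar f^Y}[af(b\bar g^Xc)]_{\bar f}-\frac{L}{\bar g^Y}[(a\bar f^Xb)gc]_{\bar g}$, $w=La\bar f^Xb\bar g^Xc$; (4) if $\bar f^Y\ne1$, for any $a,b$ with $a\bar f^Xb\in ALSW(X)$, $C_4\langle f\rangle_w=[[a\bar f^Xb],[afb]_{\bar f}]$, $w=\bar f^Y\,a\bar f^Xb\,a\bar f^Xb$. For $\mathbf{k}$-monic $S$ and $w\in[Y]X^*$, $h$ is trivial modulo $(S,w)$ if $h=\sum\alpha_i\beta_i[a_is_ib_i]_{\bar s_i}$, $\alpha_i\in\mathbf{k}$, $\beta_i\in[Y]$, $s_i\in S$, $\beta_i\bar s_i^Ya_i\bar s_i^Xb_i\prec w$. $S$ is a Gröbner–Shirshov basis in $Lie_{\mathbf{k}[Y]}(X)$ if all compositions $C_1,C_2,C_3$ of $f,g\in S$ and $C_4$ of $f\in S$ are trivial modulo $(S,w)$. All associative algebras have identity. For $S\subseteq Lie_{\mathbf{k}[Y]}(X)$,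 $Lie_K(X|S)$ is the free Lie $K$-algebra on $X$ modulo the ideal generated by the image of $S$ (coefficients reduced mod $Id(R)$); $U_K(\mathcal L)=K\langle X|S^{(-)}\rangle$ is the free associative $K$-algebra on $X$ modulo the ideal generated by $S^{(-)}$, the images of elements of $S$ with Lie brackets expanded as commutators $[u,v]=uv-vu$. *)

theory Defs
  imports Main "HOL-Library.Poly_Mapping"
begin

fun lexgt :: "'x::linorder list \<Rightarrow> 'x list \<Rightarrow> bool" where
  "lexgt [] [] = False"
| "lexgt [] (_ # _) = True"
| "lexgt (_ # _) [] = False"
| "lexgt (x # u) (y # v) = (x > y \<or> (x = y \<and> lexgt u v))"

definition deglexX :: "'x::linorder list \<Rightarrow> 'x list \<Rightarrow> bool" where
  "deglexX u v \<longleftrightarrow> length u > length v \<or> (length u = length v \<and> lexgt u v)"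

definition ALSW :: "'x::linorder list \<Rightarrow> bool" where
  "ALSW w \<longleftrightarrow> w \<noteq> [] \<and>
     (\<forall>i. 0 < i \<and> i < length w \<longrightarrow> lexgt w (drop i w @ take i w))"

definition alsw_fact :: "'x::linorder list \<Rightarrow> 'x list list" where
  "alsw_fact c = (THE cs. concat cs = c \<and> (\<forall>u\<in>set cs. ALSW u)
       \<and> sorted_wrt (\<lambda>a b. a = b \<or> lexgt b a) cs)"

text \<open>Commutative monomials [Y] with the deg-lex order: total degree first, then
  (monomials written as nonincreasing words) lexicographically, i.e. the larger
  exponent at the largest variable where they differ wins.\<close>
definition ydeg :: "('y \<Rightarrow>\<^sub>0 nat) \<Rightarrow> nat" where
  "ydeg a = (\<Sum>y\<in>Poly_Mapping.keys a. Poly_Mapping.lookup a y)"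

definition deglexY :: "('y::linorder \<Rightarrow>\<^sub>0 nat) \<Rightarrow> ('y \<Rightarrow>\<^sub>0 nat) \<Rightarrow> bool" where
  "deglexY a b \<longleftrightarrow> ydeg a > ydeg b \<or>
     (ydeg a = ydeg b \<and> a \<noteq> b \<and>
       (let y = Max {y. Poly_Mapping.lookup a y \<noteq> Poly_Mapping.lookup b y} in Poly_Mapping.lookup a y > Poly_Mapping.lookup b y))"

definition mgt :: "('y::linorder \<Rightarrow>\<^sub>0 nat) \<times> 'x::linorder list
                   \<Rightarrow> ('y \<Rightarrow>\<^sub>0 nat) \<times> 'x list \<Rightarrow> bool" where
  "mgt m m' \<longleftrightarrow> deglexX (snd m) (snd m') \<or> (snd m = snd m' \<and> deglexY (fst m) (fst m'))"

type_synonym ('x, 'y, 'k) kpoly = "(('y \<Rightarrow>\<^sub>0 nat) \<times> 'x list) \<Rightarrow>\<^sub>0 'k"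

definition pmul :: "('x, 'y, 'k::comm_ring_1) kpoly \<Rightarrow> ('x, 'y, 'k) kpoly \<Rightarrow> ('x, 'y, 'k) kpoly" where
  "pmul p q = (\<Sum>a\<in>Poly_Mapping.keys p. \<Sum>b\<in>Poly_Mapping.keys q.
      Poly_Mapping.single (fst a + fst b, snd a @ snd b) (Poly_Mapping.lookup p a * Poly_Mapping.lookup q b))"

definition bracket :: "('x, 'y, 'k::comm_ring_1) kpoly \<Rightarrow> ('x, 'y, 'k) kpoly \<Rightarrow> ('x, 'y, 'k) kpoly" where
  "bracket p q = pmul p q - pmul q p"

definition Xg :: "'x \<Rightarrow> ('x, 'y, 'k::comm_ring_1) kpoly" where
  "Xg x = Poly_Mapping.single (0, [x]) 1"

definition cY :: "('y \<Rightarrow>\<^sub>0 nat) \<Rightarrow> ('x, 'y, 'k::comm_ring_1) kpoly" where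
  "cY b = Poly_Mapping.single (b, []) 1"

definition isY :: "('x, 'y, 'k::zero) kpoly \<Rightarrow> bool" where
  "isY p \<longleftrightarrow> (\<forall>m\<in>Poly_Mapping.keys p. snd m = [])"

definition embedY :: "(('y \<Rightarrow>\<^sub>0 nat) \<Rightarrow>\<^sub>0 'k::comm_ring_1) \<Rightarrow> ('x, 'y, 'k) kpoly" where
  "embedY r = (\<Sum>b\<in>Poly_Mapping.keys r. Poly_Mapping.single (b, []) (Poly_Mapping.lookup r b))"

inductive_set LieKY :: "('x, 'y, 'k::comm_ring_1) kpoly set" where
  gen: "Xg x \<in> LieKY"
| add: "p \<in> LieKY \<Longrightarrow> q \<in> LieKY \<Longrightarrow> p + q \<in> LieKY"
| smul: "p \<in> LieKY \<Longrightarrow> isY c \<Longrightarrow> pmul c p \<in> LieKY"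
| brk: "p \<in> LieKY \<Longrightarrow> q \<in> LieKY \<Longrightarrow> bracket p q \<in> LieKY"

definition lm :: "('x::linorder, 'y::linorder, 'k::zero) kpoly \<Rightarrow> ('y \<Rightarrow>\<^sub>0 nat) \<times> 'x list" where
  "lm f = (THE m. m \<in> Poly_Mapping.keys f \<and> (\<forall>m'\<in>Poly_Mapping.keys f. m' \<noteq> m \<longrightarrow> mgt m m'))"

abbreviation LY where "LY f \<equiv> fst (lm f)"
abbreviation LX where "LX f \<equiv> snd (lm f)"

definition k_monic :: "('x::linorder, 'y::linorder, 'k::{zero,one}) kpoly \<Rightarrow> bool" where
  "k_monic f \<longleftrightarrow> f \<noteq> 0 \<and> Poly_Mapping.lookup f (lm f) = 1"

datatype 'x btree = Lf 'x | Hole | Nd "'x btree" "'x btree"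

fun tword :: "'x btree \<Rightarrow> 'x list" where
  "tword (Lf x) = [x]"
| "tword Hole = []"
| "tword (Nd l r) = tword l @ tword r"

text \<open>Standard bracketing tree: [w] = [[u],[v]], v the longest proper ALSW suffix.
  The first argument is fuel (length of the word).\<close>
fun std_tree_aux :: "nat \<Rightarrow> 'x::linorder list \<Rightarrow> 'x btree" where
  "std_tree_aux 0 w = Hole"
| "std_tree_aux (Suc n) w =
     (case w of [] \<Rightarrow> Hole
      | [x] \<Rightarrow> Lf x
      | _ \<Rightarrow> (let i = (LEAST i. 0 < i \<and> ALSW (drop i w))
             in Nd (std_tree_aux n (take i w)) (std_tree_aux n (drop i w))))"

definition std_tree :: "'x::linorder list \<Rightarrow> 'x btree" where
  "std_tree w = std_tree_aux (length w) w"

fun tev :: "('x, 'y, 'k::comm_ring_1) kpoly \<Rightarrow> 'x btree \<Rightarrow> ('x, 'y, 'k) kpoly" where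
  "tev s Hole = s"
| "tev s (Lf x) = Xg x"
| "tev s (Nd l r) = bracket (tev s l) (tev s r)"

definition brk :: "'x::linorder list \<Rightarrow> ('x, 'y, 'k::comm_ring_1) kpoly" where
  "brk w = tev 0 (std_tree w)"

text \<open>Replace the minimal sub-bracket containing positions [p, p+L) (the node [uc])
  by F applied to its word.\<close>
fun repl :: "nat \<Rightarrow> nat \<Rightarrow> ('x list \<Rightarrow> 'x btree) \<Rightarrow> nat \<Rightarrow> 'x btree \<Rightarrow> 'x btree" where
  "repl p L F off (Nd l r) =
     (let ll = length (tword l) in
      if off \<le> p \<and> p + L \<le> off + ll then Nd (repl p L F off l) r
      else if off + ll \<le> p \<and> p + L \<le> off + length (tword (Nd l r))
        then Nd l (repl p L F (off + ll) r)
      else F (tword (Nd l r)))"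
| "repl p L F off t = F (tword t)"

text \<open>Special bracketing [aub]_u with the sub-bracket [u] left as a hole:
  [uc] is replaced by [...[[u],[c1]],...,[cn]].\<close>
definition special_tree :: "'x::linorder list \<Rightarrow> 'x list \<Rightarrow> 'x list \<Rightarrow> 'x btree" where
  "special_tree a u b =
     repl (length a) (length u)
       (\<lambda>wd. foldl Nd Hole (map std_tree (alsw_fact (drop (length u) wd))))
       0 (std_tree (a @ u @ b))"

definition nsw :: "'x::linorder list \<Rightarrow> ('x, 'y::linorder, 'k::comm_ring_1) kpoly \<Rightarrow> 'x list
                   \<Rightarrow> ('x, 'y, 'k) kpoly" where
  "nsw a s b = tev s (special_tree a (LX s) b)"

definition kY_monic :: "('x::linorder, 'y::linorder, 'k::comm_ring_1) kpoly \<Rightarrow> bool" where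
  "kY_monic f \<longleftrightarrow> (\<exists>U c. finite U \<and> U \<subseteq> {u. ALSW u} \<and>
      (\<forall>u\<in>U. isY (c u) \<and> c u \<noteq> 0) \<and>
      f = (\<Sum>u\<in>U. pmul (c u) (brk u)) \<and>
      (\<exists>u1\<in>U. (\<forall>v\<in>U. v \<noteq> u1 \<longrightarrow> deglexX u1 v) \<and> c u1 = Poly_Mapping.single (0, []) 1))"

definition yscale :: "('y \<Rightarrow>\<^sub>0 nat) \<Rightarrow> ('x, 'y, 'k::comm_ring_1) kpoly \<Rightarrow> ('x, 'y, 'k) kpoly" where
  "yscale b p = pmul (cY b) p"

definition lcmY :: "('y \<Rightarrow>\<^sub>0 nat) \<Rightarrow> ('y \<Rightarrow>\<^sub>0 nat) \<Rightarrow> ('y \<Rightarrow>\<^sub>0 nat)" where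
  "lcmY a b = a + (b - a)"

definition trivial_mod :: "('x::linorder, 'y::linorder, 'k::comm_ring_1) kpoly set
     \<Rightarrow> ('y \<Rightarrow>\<^sub>0 nat) \<times> 'x list \<Rightarrow> ('x, 'y, 'k) kpoly \<Rightarrow> bool" where
  "trivial_mod S w h \<longleftrightarrow> (\<exists>ts.
      h = sum_list (map (\<lambda>(\<alpha>, \<beta>, a, s, b). pmul (Poly_Mapping.single (\<beta>, []) \<alpha>) (nsw a s b)) ts)
    \<and> (\<forall>(\<alpha>, \<beta>, a, s, b)\<in>set ts. s \<in> S \<and> ALSW (a @ LX s @ b)
          \<and> mgt w (\<beta> + LY s, a @ LX s @ b)))"

definition GSB :: "('x::linorder, 'y::linorder, 'k::comm_ring_1) kpoly set \<Rightarrow> bool" where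
  "GSB S \<longleftrightarrow>
    (\<forall>f\<in>S. \<forall>g\<in>S. let L = lcmY (LY f) (LY g) in
       (\<forall>a b. LX f = a @ LX g @ b \<longrightarrow>
          trivial_mod S (L, LX f)
            (yscale (L - LY f) f - yscale (L - LY g) (nsw a g b)))
     \<and> (\<forall>a a0 b. LX f = a @ a0 \<and> LX g = a0 @ b \<and> a \<noteq> [] \<and> b \<noteq> [] \<and> a0 \<noteq> [] \<longrightarrow>
          trivial_mod S (L, LX f @ b)
            (yscale (L - LY f) (nsw [] f b) - yscale (L - LY g) (nsw a g [])))
     \<and> ((\<exists>y. 0 < Poly_Mapping.lookup (LY f) y \<and> 0 < Poly_Mapping.lookup (LY g) y) \<longrightarrow>
          (\<forall>a b c. ALSW (a @ LX f @ b @ LX g @ c) \<longrightarrow>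
            trivial_mod S (L, a @ LX f @ b @ LX g @ c)
              (yscale (L - LY f) (nsw a f (b @ LX g @ c))
               - yscale (L - LY g) (nsw (a @ LX f @ b) g c)))))
  \<and> (\<forall>f\<in>S. LY f \<noteq> 0 \<longrightarrow>
       (\<forall>a b. ALSW (a @ LX f @ b) \<longrightarrow>
          trivial_mod S (LY f, (a @ LX f @ b) @ (a @ LX f @ b))
            (bracket (brk (a @ LX f @ b)) (nsw a f b))))"

datatype 'x mtree = MLf 'x | MNd "'x mtree" "'x mtree"

type_synonym ('x, 'y, 'k) mpoly = "(('y \<Rightarrow>\<^sub>0 nat) \<times> 'x mtree) \<Rightarrow>\<^sub>0 'k"

definition mmul :: "('x, 'y, 'k::comm_ring_1) mpoly \<Rightarrow> ('x, 'y, 'k) mpoly \<Rightarrow> ('x, 'y, 'k) mpoly" where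
  "mmul p q = (\<Sum>a\<in>Poly_Mapping.keys p. \<Sum>b\<in>Poly_Mapping.keys q.
      Poly_Mapping.single (fst a + fst b, MNd (snd a) (snd b)) (Poly_Mapping.lookup p a * Poly_Mapping.lookup q b))"

definition mscale :: "'k::comm_ring_1 \<Rightarrow> ('y \<Rightarrow>\<^sub>0 nat) \<Rightarrow> ('x, 'y, 'k) mpoly \<Rightarrow> ('x, 'y, 'k) mpoly" where
  "mscale c b p = (\<Sum>a\<in>Poly_Mapping.keys p. Poly_Mapping.single (b + fst a, snd a) (c * Poly_Mapping.lookup p a))"

definition mY :: "(('y \<Rightarrow>\<^sub>0 nat) \<Rightarrow>\<^sub>0 'k::comm_ring_1) \<Rightarrow> ('x, 'y, 'k) mpoly \<Rightarrow> ('x, 'y, 'k) mpoly" where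
  "mY r p = (\<Sum>b\<in>Poly_Mapping.keys r. mscale (Poly_Mapping.lookup r b) b p)"

fun mtev :: "'x mtree \<Rightarrow> ('x, 'y, 'k::comm_ring_1) kpoly" where
  "mtev (MLf x) = Xg x"
| "mtev (MNd l r) = bracket (mtev l) (mtev r)"

definition mev :: "('x, 'y, 'k::comm_ring_1) mpoly \<Rightarrow> ('x, 'y, 'k) kpoly" where
  "mev p = (\<Sum>a\<in>Poly_Mapping.keys p. pmul (Poly_Mapping.single (fst a, []) (Poly_Mapping.lookup p a)) (mtev (snd a)))"

inductive_set mideal :: "('x, 'y, 'k::comm_ring_1) mpoly set \<Rightarrow> ('x, 'y, 'k) mpoly set"
  for G where
  gen: "g \<in> G \<Longrightarrow> g \<in> mideal G"
| zero: "0 \<in> mideal G"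
| add: "p \<in> mideal G \<Longrightarrow> q \<in> mideal G \<Longrightarrow> p + q \<in> mideal G"
| scale: "p \<in> mideal G \<Longrightarrow> mscale c b p \<in> mideal G"
| mulr: "p \<in> mideal G \<Longrightarrow> mmul p q \<in> mideal G"
| mull: "p \<in> mideal G \<Longrightarrow> mmul q p \<in> mideal G"

inductive_set aideal :: "('x, 'y, 'k::comm_ring_1) kpoly set \<Rightarrow> ('x, 'y, 'k) kpoly set"
  for G where
  gen: "g \<in> G \<Longrightarrow> g \<in> aideal G"
| zero: "0 \<in> aideal G"
| add: "p \<in> aideal G \<Longrightarrow> q \<in> aideal G \<Longrightarrow> p + q \<in> aideal G"
| mulr: "p \<in> aideal G \<Longrightarrow> pmul p q \<in> aideal G"
| mull: "p \<in> aideal G \<Longrightarrow> pmul q p \<in> aideal G"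

text \<open>Defining relations of Lie_K(X|S) as a quotient of the free magma k[Y]-algebra:
  [p,p] = 0, Jacobi, coefficients in Id(R), and (lifts of) the elements of S.\<close>
definition LieRels :: "(('y \<Rightarrow>\<^sub>0 nat) \<Rightarrow>\<^sub>0 'k) set \<Rightarrow> ('x, 'y, 'k::comm_ring_1) kpoly set
                        \<Rightarrow> ('x, 'y, 'k) mpoly set" where
  "LieRels R S =
      {mmul p p | p. True}
    \<union> {mmul (mmul p q) r + mmul (mmul q r) p + mmul (mmul r p) q | p q r. True}
    \<union> {mY r m | r m. r \<in> R}
    \<union> {m. mev m \<in> S}"

text \<open>Defining relations of U_K(L) = K<X|S^(-)> inside k[Y]<X>.\<close>
definition URels :: "(('y \<Rightarrow>\<^sub>0 nat) \<Rightarrow>\<^sub>0 'k) set \<Rightarrow> ('x, 'y, 'k::comm_ring_1) kpoly set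
                     \<Rightarrow> ('x, 'y, 'k) kpoly set" where
  "URels R S = S \<union> embedY ` R"

end

theory Submission
  imports Defs "HOL.Modules"
begin

text \<open>
  Put \<open>A = k[Y]\<close>. Since every \<open>s \<in> S\<close> is \<open>A\<close>-monic, its leading monomial is a word, an ALSW, with
  coefficient \<open>1\<close>; only the compositions of inclusion and overlap matter, and everything may be done
  over the ring of scalars \<open>A\<close>. A normal \<open>s\<close>-word \<open>[asb]\<close> equals the associative \<open>s\<close>-word \<open>asb\<close> plus
  \<open>s\<close>-words with smaller leading words, so Lie triviality of the compositions makes \<open>S\<close> an associative
  Groebner basis of the ideal it generates in \<open>A\<langle>X\<rangle>\<close>.

  On the Lie side the standard bracketings \<open>[u]\<close> span the free Lie algebra (Hall's rewriting
  procedure), and modulo \<open>S\<close> those whose word \<open>u\<close> contains no leading word of \<open>S\<close> suffice. If a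
  combination \<open>\<Sum>c\<^sub>u[u]\<close> of these lies in the associative ideal generated by \<open>S\<close> and \<open>R\<close>, consider the
  largest word whose coefficient is not in \<open>Id(R)\<close>: computed from the \<open>[u]\<close> it is irreducible, computed
  from the ideal it is reducible. Hence all \<open>c\<^sub>u\<close> lie in \<open>Id(R)\<close> and the combination vanishes in
  \<open>Lie\<^sub>K(X|S)\<close>.
\<close>

section \<open>Associative Lyndon-Shirshov words\<close>

text \<open>Coefficients are taken in \<open>k[Y]\<close> and eventually modulo an ideal, so the
  scalars need be neither a field nor a domain and no leading coefficient may be divided by. The
  argument therefore uses only families whose leading coefficients are exactly \<open>1\<close>:
  standard bracketings, normal s-words, and one chosen s-word for each reducible word. For such a
  unitriangular family leading words can be read modulo any ideal \<open>I\<close> of coefficients.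
  This is where \<open>R\<close> enters, with \<open>I\<close> the annihilator of the quotient Lie
  algebra, so that membership of a coefficient in \<open>I\<close> kills its term at once.

  No model of the free Lie algebra is constructed. Lie elements are represented in the free
  nonassociative algebra, and \<open>mev\<close> expands brackets as commutators; injectivity says
  that an element whose image lies in the associative ideal already lies in the Lie ideal.
  Coefficients on the Lie side are read off from associative leading words: an element is expanded
  modulo the Lie axioms alone, which \<open>mev\<close> sends to zero, and the images are
  compared.\<close>

lemma lexgt_irrefl [simp]: "\<not> lexgt u u"
  by (induction u) auto

lemma lexgt_trans: "lexgt u v \<Longrightarrow> lexgt v w \<Longrightarrow> lexgt u w"
proof (induction u v arbitrary: w rule: lexgt.induct)
  case (2 y v) then show ?case by (cases w) auto
next
  case (4 x u y v) then show ?case by (cases w) auto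
qed auto

lemma lexgt_total: "u \<noteq> v \<Longrightarrow> lexgt u v \<or> lexgt v u"
  by (induction u v rule: lexgt.induct) auto

lemma lexgt_asym: "lexgt u v \<Longrightarrow> \<not> lexgt v u"
  using lexgt_trans lexgt_irrefl by blast

lemma lexgt_append_same [simp]: "lexgt (x @ u) (x @ v) = lexgt u v"
  by (induction x) auto

lemma lexgt_append_self [simp]: "lexgt u (u @ v) \<longleftrightarrow> v \<noteq> []"
  by (induction u; cases v; simp)

text \<open>When \<open>u\<close> is not a prefix of \<open>v\<close>, the comparison is decided at
  a letter where the words differ, so later letters cannot change it. A prefix exceeds its
  extensions, hence the side condition.\<close>

lemma lexgt_not_prefix:
  "lexgt u v \<Longrightarrow> \<nexists>t. v = u @ t \<Longrightarrow> lexgt (u @ x) (v @ y)"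
  by (induction u v rule: lexgt.induct) auto

lemma lexgt_append_longer:
  "lexgt u v \<Longrightarrow> length v \<le> length u \<Longrightarrow> lexgt (u @ x) (v @ y)"
  by (rule lexgt_not_prefix) auto

lemma lexgt_append_same_right:
  "length u = length v \<Longrightarrow> lexgt (u @ x) (v @ x) \<longleftrightarrow> lexgt u v"
  by (induction u v rule: list_induct2) auto

lemma lexgt_shorten: "lexgt (u @ x) v \<Longrightarrow> lexgt u v"
  using lexgt_trans[of u "u @ x" v] by (cases "x = []") auto

lemma deglexX_irrefl [simp]: "\<not> deglexX u u"
  by (simp add: deglexX_def)

lemma deglexX_trans: "deglexX u v \<Longrightarrow> deglexX v w \<Longrightarrow> deglexX u w"
  using lexgt_trans[of u v w] by (auto simp: deglexX_def)

lemma deglexX_asym: "deglexX u v \<Longrightarrow> \<not> deglexX v u"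
  using deglexX_trans deglexX_irrefl by blast

lemma deglexX_total: "u \<noteq> v \<Longrightarrow> deglexX u v \<or> deglexX v u"
  unfolding deglexX_def using lexgt_total by (metis linorder_neqE_nat)

lemma deglexX_append_left [simp]: "deglexX (x @ u) (x @ v) = deglexX u v"
  by (simp add: deglexX_def)

lemma deglexX_append_right [simp]: "deglexX (u @ x) (v @ x) = deglexX u v"
  by (auto simp: deglexX_def lexgt_append_same_right)

lemma lexgt_iff_lex: "length u = length v \<Longrightarrow> lexgt u v \<longleftrightarrow> (v, u) \<in> lex {(a, b). a < b}"
  by (induction u v rule: list_induct2) auto

lemma wf_deglexX: "wf {(v, u). deglexX u (v :: 'x::wellorder list)}"
proof -
  have "{(v, u). deglexX u (v :: 'x list)} \<subseteq> lenlex {(a, b). a < b}"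
    by (auto simp: deglexX_def lenlex_def lexgt_iff_lex)
  then show ?thesis
    by (rule wf_subset[OF wf_lenlex[OF wf]])
qed

lemma finite_deglexX_max:
  "finite F \<Longrightarrow> F \<noteq> {} \<Longrightarrow> \<exists>w\<in>F. \<forall>v\<in>F. v \<noteq> w \<longrightarrow> deglexX w v"
proof (induction F rule: finite_ne_induct)
  case (singleton x)
  show ?case by simp
next
  case (insert x F)
  then obtain w where w: "w \<in> F" "\<forall>v\<in>F. v \<noteq> w \<longrightarrow> deglexX w v" by blast
  show ?case
  proof (cases "deglexX w x")
    case True
    then show ?thesis using w by (intro bexI[of _ w]) simp_all
  next
    case False
    have "x \<noteq> w" using insert.hyps w(1) by metis
    then have xw: "deglexX x w" using False deglexX_total by metis
    have "deglexX x v" if "v \<in> F" for v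
      using w(2) that xw deglexX_trans[of x w v] by (cases "v = w") simp_all
    then show ?thesis by (intro bexI[of _ x]) simp_all
  qed
qed

section \<open>ALSWs as the words greater than all their proper suffixes\<close>

lemma lexgt_suffix_imp_rotation: "lexgt (u @ v) v \<Longrightarrow> lexgt (u @ v) (v @ u)"
  using lexgt_trans[of "u @ v" v "v @ u"] by (cases "u = []") auto

lemma ALSW_rotate: "ALSW (u @ v) \<Longrightarrow> u \<noteq> [] \<Longrightarrow> v \<noteq> [] \<Longrightarrow> lexgt (u @ v) (v @ u)"
  unfolding ALSW_def by (drule conjunct2, drule spec[of _ "length u"]) simp

text \<open>Suppose \<open>v\<close> exceeds \<open>u @ v\<close>. If \<open>v\<close> is not a
  prefix of \<open>u @ v\<close>, the difference survives appending \<open>u\<close>, and the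
  rotation \<open>v @ u\<close> is too large. Otherwise \<open>u @ v = v @ t\<close> with
  \<open>t\<close> as long as \<open>u\<close>; comparison with the rotation \<open>v @ u\<close>
  gives \<open>t > u\<close>, and with \<open>t @ v\<close> it gives \<open>u > t\<close>.\<close>

lemma ALSW_gt_suffix:
  assumes "ALSW (u @ v)" "u \<noteq> []" "v \<noteq> []"
  shows "lexgt (u @ v) v"
proof (rule ccontr)
  assume n: "\<not> lexgt (u @ v) v"
  have g: "lexgt v (u @ v)"
    using n lexgt_total[of v "u @ v"] assms by auto
  show False
  proof (cases "\<exists>t. u @ v = v @ t")
    case False
    then have "lexgt (v @ u) ((u @ v) @ [])"
      by (rule lexgt_not_prefix[OF g])
    then have "lexgt (v @ u) (u @ v)" by simp
    then show False using lexgt_asym[OF ALSW_rotate[OF assms]] by simp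
  next
    case True
    then obtain t where t: "u @ v = v @ t" by blast
    have "length (u @ v) = length (v @ t)" using t by simp
    then have l: "length t = length u" by simp
    then have "t \<noteq> []" using assms by auto
    have "lexgt t u" using ALSW_rotate[OF assms] t by simp
    moreover have "lexgt (v @ t) (t @ v)"
      using ALSW_rotate[of v t] assms t \<open>t \<noteq> []\<close> by simp
    then have "lexgt (u @ v) (t @ v)" unfolding t .
    then have "lexgt u t" using l lexgt_append_same_right[of u t v] by simp
    ultimately show False using lexgt_asym[of t u] by simp
  qed
qed

lemma ALSW_iff_gt_suffix:
  "ALSW w \<longleftrightarrow> w \<noteq> [] \<and> (\<forall>u v. w = u @ v \<longrightarrow> u \<noteq> [] \<longrightarrow> v \<noteq> [] \<longrightarrow> lexgt w v)"
    (is "_ \<longleftrightarrow> ?R")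
proof
  assume a: "ALSW w"
  show ?R
  proof (intro conjI allI impI)
    show "w \<noteq> []" using a by (simp add: ALSW_def)
    fix u v assume "w = u @ v" "u \<noteq> []" "v \<noteq> []"
    then show "lexgt w v" using a ALSW_gt_suffix[of u v] by simp
  qed
next
  assume r: ?R
  have "lexgt w (drop i w @ take i w)" if i: "0 < i" "i < length w" for i
  proof -
    have "take i w \<noteq> []" "drop i w \<noteq> []" using i by auto
    moreover have "w = take i w @ drop i w" by simp
    ultimately have "lexgt w (drop i w)" using r by metis
    then have "lexgt (take i w @ drop i w) (drop i w)" by simp
    from lexgt_suffix_imp_rotation[OF this] show ?thesis by simp
  qed
  with r show "ALSW w" by (simp add: ALSW_def)
qed

lemma ALSW_not_Nil: "ALSW w \<Longrightarrow> w \<noteq> []"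
  by (simp add: ALSW_def)

lemma ALSW_singleton [simp]: "ALSW [x]"
  by (auto simp: ALSW_def)

text \<open>The point is that \<open>u @ v\<close> exceeds \<open>v\<close>; all other suffixes then
  follow from \<open>u\<close> and \<open>v\<close> being ALSW. If \<open>v = u @ t\<close>, then
  \<open>v > t\<close> gives \<open>u @ v > u @ t = v\<close>; otherwise \<open>u > v\<close> is
  decided at a differing letter.\<close>

lemma ALSW_append:
  assumes u: "ALSW u" and v: "ALSW v" and gt: "lexgt u v"
  shows "ALSW (u @ v)"
proof -
  have uv: "lexgt (u @ v) v"
  proof (cases "\<exists>t. v = u @ t")
    case True
    then obtain t where t: "v = u @ t" by blast
    then have "t \<noteq> []" using gt by auto
    then have "lexgt v t" using ALSW_gt_suffix[of u t] t v ALSW_not_Nil[OF u] by simp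
    then have "lexgt (u @ v) (u @ t)" by simp
    with t show ?thesis by simp
  next
    case False
    then show ?thesis using lexgt_not_prefix[OF gt False, of v "[]"] by simp
  qed
  show ?thesis
    unfolding ALSW_iff_gt_suffix
  proof (intro conjI allI impI)
    fix p q assume pq: "u @ v = p @ q" "p \<noteq> []" "q \<noteq> []"
    from pq(1) obtain t where "u = p @ t \<and> t @ v = q \<or> u @ t = p \<and> v = t @ q"
      unfolding append_eq_append_conv2 by blast
    then consider "t = []" "v = q" | "t \<noteq> []" "u = p @ t" "q = t @ v"  | "t \<noteq> []" "v = t @ q"
      by (cases "t = []") auto
    then show "lexgt (u @ v) q"
    proof cases
      case 2
      then have "lexgt u t" using ALSW_gt_suffix[of p t] u pq by simp
      then show ?thesis using lexgt_append_longer[of u t v v] 2 by simp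
    next
      case 3
      then have "lexgt v q" using ALSW_gt_suffix[of t q] v pq by simp
      then show ?thesis using uv lexgt_trans by blast
    qed (use uv in auto)
  qed (use ALSW_not_Nil[OF u] in auto)
qed

text \<open>A suffix starting inside \<open>x\<close> still contains \<open>y\<close> and already
  loses against \<open>x @ y\<close>, being shorter there, so appending \<open>z\<close> changes
  nothing. A suffix starting later is a suffix of \<open>y @ z\<close>, which is itself at most the
  whole word.\<close>

lemma ALSW_overlap:
  assumes xy: "ALSW (x @ y)" and yz: "ALSW (y @ z)" and y: "y \<noteq> []"
  shows "ALSW (x @ y @ z)"
proof (cases "x = []")
  case False
  have gt: "lexgt (x @ y @ z) (t @ y @ z)" if "x = p @ t" "p \<noteq> []" for p t
  proof -
    have "lexgt (x @ y) (t @ y)" using ALSW_gt_suffix[of p "t @ y"] xy that y by simp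
    then show ?thesis using lexgt_append_longer[of "x @ y" "t @ y" z z] that by simp
  qed
  show ?thesis
    unfolding ALSW_iff_gt_suffix
  proof (intro conjI allI impI)
    fix p q assume pq: "x @ y @ z = p @ q" "p \<noteq> []" "q \<noteq> []"
    from pq(1) obtain t where "x = p @ t \<and> t @ y @ z = q \<or> x @ t = p \<and> y @ z = t @ q"
      unfolding append_eq_append_conv2[of x] by blast
    then consider "x = p @ t" "q = t @ y @ z" | "t \<noteq> []" "y @ z = t @ q"
      by (cases "t = []") auto
    then show "lexgt (x @ y @ z) q"
    proof cases
      case 1
      then show ?thesis using gt pq by simp
    next
      case 2
      then have "lexgt (y @ z) q" using ALSW_gt_suffix[of t q] yz pq by simp
      moreover have "lexgt (x @ y @ z) (y @ z)" using gt[of x "[]"] False by simp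
      ultimately show ?thesis using lexgt_trans by blast
    qed
  qed (use False in auto)
qed (use yz in auto)

section \<open>Factorization of words into nondecreasing ALSWs\<close>

definition alsw_le :: "'x::linorder list \<Rightarrow> 'x list \<Rightarrow> bool" where
  "alsw_le a b \<longleftrightarrow> a = b \<or> lexgt b a"

lemma alsw_le_trans: "alsw_le a b \<Longrightarrow> alsw_le b c \<Longrightarrow> alsw_le a c"
  unfolding alsw_le_def using lexgt_trans by blast

lemma not_alsw_le: "\<not> alsw_le a b \<longleftrightarrow> lexgt a b"
  unfolding alsw_le_def using lexgt_total lexgt_asym lexgt_irrefl by blast

definition alsw_facts :: "'x::linorder list list \<Rightarrow> bool" where
  "alsw_facts cs \<longleftrightarrow> (\<forall>u\<in>set cs. ALSW u) \<and> sorted_wrt alsw_le cs"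

lemma ALSW_suffix_le: "ALSW (u @ v) \<Longrightarrow> v \<noteq> [] \<Longrightarrow> alsw_le v (u @ v)"
  using ALSW_gt_suffix[of u v] by (cases "u = []") (auto simp: alsw_le_def)

text \<open>A factorization into ALSWs with the fewest factors is nondecreasing, since a descent
  between neighbours could be merged by \<open>ALSW_append\<close>. The single letters show that
  some factorization exists.\<close>

lemma alsw_facts_exists: "\<exists>cs. concat cs = c \<and> alsw_facts cs"
proof -
  let ?P = "\<lambda>cs. concat cs = c \<and> (\<forall>u\<in>set cs. ALSW u)"
  have "?P (map (\<lambda>x. [x]) c)" by auto
  then obtain cs where cs: "?P cs" and min: "\<And>ds. ?P ds \<Longrightarrow> length cs \<le> length ds"
    using ex_has_least_nat[of ?P _ length] by blast
  have "alsw_le (cs ! i) (cs ! Suc i)" if i: "Suc i < length cs" for i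
  proof (rule ccontr)
    assume "\<not> ?thesis"
    then have gt: "lexgt (cs ! i) (cs ! Suc i)" by (simp add: not_alsw_le)
    let ?ds = "take i cs @ (cs ! i @ cs ! Suc i) # drop (Suc (Suc i)) cs"
    have eq: "cs = take i cs @ cs ! i # cs ! Suc i # drop (Suc (Suc i)) cs"
      using i by (metis Cons_nth_drop_Suc Suc_lessD id_take_nth_drop)
    have "concat ?ds = concat (take i cs @ cs ! i # cs ! Suc i # drop (Suc (Suc i)) cs)" by simp
    then have "concat ?ds = c" using eq cs by presburger
    moreover have "\<forall>u\<in>set ?ds. ALSW u"
      using cs i gt ALSW_append by (auto dest: in_set_takeD in_set_dropD)
    ultimately have "length cs \<le> length ?ds" using min by blast
    then show False using i by simp
  qed
  then have "sorted_wrt alsw_le cs"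
    by (subst sorted_wrt_iff_nth_Suc_transp)
      (use alsw_le_trans cs in \<open>auto simp: transp_def\<close>)
  then show ?thesis using cs by (auto simp: alsw_facts_def)
qed

text \<open>If the product were ALSW, it would exceed its last factor \<open>v\<close>, and so would
  the first factor, being a prefix; this contradicts the sorting. Below it rules out ALSW suffixes
  longer than expected.\<close>

lemma alsw_facts_snoc_not_ALSW:
  assumes "alsw_facts (xs @ [v])" "xs \<noteq> []"
  shows "\<not> ALSW (concat xs @ v)"
proof
  assume a: "ALSW (concat xs @ v)"
  obtain x ys where xs: "xs = x # ys" using assms by (cases xs) auto
  have nn: "x \<noteq> []" "v \<noteq> []" using assms xs ALSW_not_Nil by (auto simp: alsw_facts_def)
  then have "lexgt (concat xs @ v) v" using ALSW_gt_suffix[OF a] xs by simp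
  then have "lexgt x v" using lexgt_shorten[of x "concat ys @ v"] xs by simp
  moreover have "alsw_le x v" using assms xs by (auto simp: alsw_facts_def)
  ultimately show False using not_alsw_le by blast
qed

text \<open>Gives uniqueness: the last factor is determined as the longest ALSW suffix. If
  \<open>t @ d\<close> were ALSW, then \<open>t > d\<close>; but \<open>t\<close> begins with a
  suffix of some factor \<open>c\<close>, and that suffix is at most \<open>c\<close>, hence at most
  \<open>d\<close>.\<close>

lemma alsw_facts_last_longest:
  assumes "alsw_facts (cs @ [d])" "ALSW y" "concat cs @ d = p @ y"
  shows "length y \<le> length d"
proof (rule ccontr)
  assume n: "\<not> ?thesis"
  have dn: "d \<noteq> []" "ALSW d" using assms ALSW_not_Nil by (auto simp: alsw_facts_def)
  have "y \<noteq> []" using n by auto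
  from assms(3) obtain t where "concat cs = p @ t \<and> t @ d = y \<or> concat cs @ t = p \<and> d = t @ y"
    unfolding append_eq_append_conv2 by blast
  with n have t: "concat cs = p @ t" "y = t @ d" "t \<noteq> []" by auto
  then have "lexgt y d" using ALSW_gt_suffix[of t d] assms(2) dn by simp
  then have td: "lexgt t d" using lexgt_shorten t by metis
  have "\<exists>c\<in>set cs. \<exists>z r q. c = q @ z \<and> z \<noteq> [] \<and> t = z @ r"
    using t(1) t(3)
  proof (induction cs arbitrary: p)
    case (Cons c cs)
    then have "c @ concat cs = p @ t" by simp
    then obtain z where "c = p @ z \<and> z @ concat cs = t \<or> c @ z = p \<and> concat cs = z @ t"
      unfolding append_eq_append_conv2 by blast
    then consider "z \<noteq> []" "c = p @ z" "t = z @ concat cs" | "concat cs = z @ t"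
      by (cases "z = []") auto
    then show ?case
    proof cases
      case 1 then show ?thesis by auto
    next
      case 2
      then show ?thesis using Cons.IH[of z] Cons.prems(2) by auto
    qed
  qed auto
  then obtain c z r q where c: "c \<in> set cs" "c = q @ z" "z \<noteq> []" "t = z @ r" by blast
  have "alsw_le z c" using ALSW_suffix_le c assms(1) by (auto simp: alsw_facts_def)
  moreover have "alsw_le c d" using assms c by (auto simp: alsw_facts_def sorted_wrt_append)
  ultimately have "alsw_le z d" using alsw_le_trans by blast
  moreover have "lexgt z d" using td c lexgt_shorten by blast
  ultimately show False using not_alsw_le by blast
qed

lemma alsw_facts_unique:
  "alsw_facts cs \<Longrightarrow> alsw_facts ds \<Longrightarrow> concat cs = concat ds \<Longrightarrow> cs = ds"
proof (induction cs arbitrary: ds rule: rev_induct)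
  case Nil
  then show ?case by (cases ds) (auto simp: alsw_facts_def dest: ALSW_not_Nil)
next
  case (snoc d cs)
  then have "ds \<noteq> []" by (auto simp: alsw_facts_def dest: ALSW_not_Nil)
  then obtain es e where ds: "ds = es @ [e]" using rev_exhaust by blast
  have eq: "concat cs @ d = concat es @ e" using snoc ds by simp
  have "ALSW d" "ALSW e" using snoc ds by (auto simp: alsw_facts_def)
  then have "length d = length e"
    using alsw_facts_last_longest[of cs d e "concat es"] alsw_facts_last_longest[of es e d "concat cs"]
      snoc.prems ds eq by force
  then have "concat cs = concat es" "d = e" using eq by auto
  then show ?case using snoc ds by (auto simp: alsw_facts_def sorted_wrt_append)
qed

lemma alsw_fact: "concat (alsw_fact c) = c" "alsw_facts (alsw_fact c)"
proof -
  have le: "(\<lambda>a b. a = b \<or> lexgt b a) = alsw_le" by (auto simp: alsw_le_def fun_eq_iff)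
  have "\<exists>!cs. concat cs = c \<and> alsw_facts cs"
    using alsw_facts_exists alsw_facts_unique by blast
  from theI'[OF this] show "concat (alsw_fact c) = c" "alsw_facts (alsw_fact c)"
    unfolding alsw_fact_def le alsw_facts_def by blast+
qed

section \<open>The standard factorization of an ALSW\<close>

definition std_cut :: "'x::linorder list \<Rightarrow> nat" where
  "std_cut w = (LEAST i. 0 < i \<and> ALSW (drop i w))"

lemma std_cut:
  assumes "2 \<le> length w"
  shows "0 < std_cut w" "std_cut w < length w" "ALSW (drop (std_cut w) w)"
proof -
  let ?P = "\<lambda>i. 0 < i \<and> ALSW (drop i w)"
  have "drop (length w - 1) w = [last w]"
    using assms by (cases w rule: rev_cases) auto
  then have P: "?P (length w - 1)" using assms by simp
  from LeastI[of ?P, OF P] show "0 < std_cut w" "ALSW (drop (std_cut w) w)"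
    by (auto simp: std_cut_def)
  have "std_cut w \<le> length w - 1" unfolding std_cut_def using P by (rule Least_le)
  then show "std_cut w < length w" using assms by simp
qed

lemma std_cut_le: "w = p @ y \<Longrightarrow> p \<noteq> [] \<Longrightarrow> ALSW y \<Longrightarrow> std_cut w \<le> length p"
  unfolding std_cut_def by (rule Least_le) simp

lemma std_cut_eqI:
  assumes "p \<noteq> []" "ALSW y" "\<And>q x. p = q @ x \<Longrightarrow> q \<noteq> [] \<Longrightarrow> x \<noteq> [] \<Longrightarrow> \<not> ALSW (x @ y)"
  shows "std_cut (p @ y) = length p"
proof -
  have l: "2 \<le> length (p @ y)" using assms ALSW_not_Nil[OF assms(2)] by (cases p; cases y) auto
  have le: "std_cut (p @ y) \<le> length p" using std_cut_le assms by blast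
  show ?thesis
  proof (rule ccontr)
    assume "\<not> ?thesis"
    then have lt: "std_cut (p @ y) < length p" using le by simp
    then have "ALSW (drop (std_cut (p @ y)) p @ y)" using std_cut(3)[OF l] by simp
    moreover have "p = take (std_cut (p @ y)) p @ drop (std_cut (p @ y)) p" by simp
    moreover have "take (std_cut (p @ y)) p \<noteq> []" "drop (std_cut (p @ y)) p \<noteq> []"
      using lt std_cut(1)[OF l] by auto
    ultimately show False using assms(3) by blast
  qed
qed

text \<open>If the left part had several nondecreasing factors, the last one \<open>d\<close> would
  be at most the right part \<open>v\<close>, for otherwise \<open>d @ v\<close> is a longer proper
  ALSW suffix. Appending \<open>v\<close> would then factor \<open>w\<close> nondecreasingly into
  more than one piece.\<close>

lemma ALSW_std_left:
  assumes "ALSW w" "2 \<le> length w"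
  shows "ALSW (take (std_cut w) w)"
proof -
  let ?u = "take (std_cut w) w" and ?v = "drop (std_cut w) w"
  obtain cs where cs: "concat cs = ?u" "alsw_facts cs" using alsw_facts_exists by blast
  have "?u \<noteq> []" using std_cut[OF assms(2)] assms ALSW_not_Nil by auto
  then have "cs \<noteq> []" using cs by auto
  then obtain ds d where ds: "cs = ds @ [d]" using rev_exhaust by blast
  have dA: "ALSW d" using cs ds by (auto simp: alsw_facts_def)
  show ?thesis
  proof (cases "ds = []")
    case False
    have "ALSW (hd ds)" using cs ds False by (simp add: alsw_facts_def)
    then have "hd ds \<noteq> []" by (rule ALSW_not_Nil)
    then have dsn: "concat ds \<noteq> []" using False by (cases ds) auto
    have cd: "concat ds @ d = ?u" using cs ds by simp
    have "\<not> lexgt d ?v"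
    proof
      assume "lexgt d ?v"
      then have "ALSW (d @ ?v)" using ALSW_append dA std_cut[OF assms(2)] by blast
      moreover have "w = concat ds @ (d @ ?v)" using cd
        by (metis append_assoc append_take_drop_id)
      ultimately have "std_cut w \<le> length (concat ds)" using std_cut_le dsn by blast
      moreover have "std_cut w = length (concat ds @ d)" using std_cut[OF assms(2)]
        unfolding cd by simp
      ultimately show False using ALSW_not_Nil[OF dA] by simp
    qed
    then have dv: "alsw_le d ?v" using not_alsw_le by blast
    have "alsw_facts (cs @ [?v])"
      using cs ds dv std_cut[OF assms(2)]
      by (auto simp: alsw_facts_def sorted_wrt_append intro: alsw_le_trans)
    then have "\<not> ALSW (concat cs @ ?v)" using alsw_facts_snoc_not_ALSW ds by blast
    then show ?thesis using assms cs by simp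
  next
    case True
    then show ?thesis using cs ds dA by simp
  qed
qed

text \<open>Hall's condition for the bracket of \<open>[u]\<close> and \<open>[v]\<close> to be
  standard already. A proper ALSW suffix of \<open>u\<close> is a suffix of the right standard
  factor of \<open>u\<close>, hence at most \<open>v\<close>. So a proper suffix \<open>x\<close> of
  \<open>u\<close> followed by \<open>v\<close> factors nondecreasingly into several pieces and is
  not ALSW.\<close>

lemma std_cut_append:
  assumes u: "ALSW u" and v: "ALSW v" and gt: "lexgt u v"
    and st: "2 \<le> length u \<Longrightarrow> \<not> lexgt (drop (std_cut u) u) v"
  shows "std_cut (u @ v) = length u"
proof (rule std_cut_eqI)
  fix q x assume qx: "u = q @ x" "q \<noteq> []" "x \<noteq> []"
  then have l: "2 \<le> length u" by (cases q; cases x) auto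
  obtain cs where cs: "concat cs = x" "alsw_facts cs" using alsw_facts_exists by blast
  then have "cs \<noteq> []" using qx by auto
  then obtain ds d where ds: "cs = ds @ [d]" using rev_exhaust by blast
  have dA: "ALSW d" using cs ds by (auto simp: alsw_facts_def)
  let ?w = "drop (std_cut u) u"
  have e: "u = (q @ concat ds) @ d" using qx cs ds by simp
  define n where "n = std_cut u"
  have "n \<le> length (q @ concat ds)" using std_cut_le[OF e _ dA] qx(2) n_def by simp
  then have "drop n ((q @ concat ds) @ d) = drop n (q @ concat ds) @ d" by simp
  then have "?w = drop n (q @ concat ds) @ d" using e n_def by argo
  then have "alsw_le d ?w"
    using ALSW_suffix_le[of "drop n (q @ concat ds)" d] ALSW_not_Nil[OF dA] std_cut(3)[OF l] by argo
  moreover have "alsw_le ?w v" using st[OF l] not_alsw_le by blast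
  ultimately have "alsw_le d v" using alsw_le_trans by blast
  then have "alsw_facts (cs @ [v])"
    using cs ds v by (auto simp: alsw_facts_def sorted_wrt_append intro: alsw_le_trans)
  then show "\<not> ALSW (x @ v)" using alsw_facts_snoc_not_ALSW[of cs v] cs(1) \<open>cs \<noteq> []\<close> by simp
qed (use u v ALSW_not_Nil in auto)

section \<open>Algebras over the polynomial ring k[Y]\<close>

lemma poly_mapping_add_induct [case_names zero single add]:
  fixes p :: "'a \<Rightarrow>\<^sub>0 'b::comm_monoid_add"
  assumes "P 0" "\<And>k c. P (Poly_Mapping.single k c)" "\<And>p q. P p \<Longrightarrow> P q \<Longrightarrow> P (p + q)"
  shows "P p"
proof -
  have s: "P (sum f F)" if "finite F" "\<And>k. P (f k)" for f and F :: "'a set"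
    using that by (induction F rule: finite_induct) (auto intro: assms)
  have "p = (\<Sum>k\<in>Poly_Mapping.keys p. Poly_Mapping.single k (Poly_Mapping.lookup p k))"
    by (rule poly_mapping_eqI)
      (auto simp: lookup_sum lookup_single when_def in_keys_iff sum.delta)
  then show ?thesis using s assms(2) finite_keys by metis
qed

text \<open>Common shape of \<open>pmul\<close>, \<open>mmul\<close>, \<open>mY\<close> and
  \<open>embedY\<close>: an operation on basis elements extended bilinearly, so that additivity is
  proved once.\<close>

definition bilin :: "('a \<Rightarrow> 'b \<Rightarrow> 'c) \<Rightarrow> ('a \<Rightarrow>\<^sub>0 'k) \<Rightarrow> ('b \<Rightarrow>\<^sub>0 'k) \<Rightarrow> ('c \<Rightarrow>\<^sub>0 'k::comm_ring_1)" where
  "bilin f p q = (\<Sum>a\<in>Poly_Mapping.keys p. \<Sum>b\<in>Poly_Mapping.keys q.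
     Poly_Mapping.single (f a b) (Poly_Mapping.lookup p a * Poly_Mapping.lookup q b))"

text \<open>The support of a sum may shrink by cancellation; summing over a common finite superset
  makes the two sides of the additivity laws comparable.\<close>

lemma bilin_superset:
  assumes "finite F" "finite G" "Poly_Mapping.keys p \<subseteq> F" "Poly_Mapping.keys q \<subseteq> G"
  shows "bilin f p q = (\<Sum>a\<in>F. \<Sum>b\<in>G.
     Poly_Mapping.single (f a b) (Poly_Mapping.lookup p a * Poly_Mapping.lookup q b))"
proof -
  have "bilin f p q = (\<Sum>a\<in>Poly_Mapping.keys p. \<Sum>b\<in>G.
     Poly_Mapping.single (f a b) (Poly_Mapping.lookup p a * Poly_Mapping.lookup q b))"
    unfolding bilin_def using assms
    by (intro sum.cong refl sum.mono_neutral_left) (auto simp: in_keys_iff)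
  also have "\<dots> = (\<Sum>a\<in>F. \<Sum>b\<in>G.
     Poly_Mapping.single (f a b) (Poly_Mapping.lookup p a * Poly_Mapping.lookup q b))"
    using assms by (intro sum.mono_neutral_left) (auto simp: in_keys_iff)
  finally show ?thesis .
qed

lemma bilin_add_left: "bilin f (p + p') q = bilin f p q + bilin f p' q"
proof -
  let ?F = "Poly_Mapping.keys p \<union> Poly_Mapping.keys p'"
  have "Poly_Mapping.keys (p + p') \<subseteq> ?F" by (rule keys_add)
  then show ?thesis
    by (simp add: bilin_superset[of ?F "Poly_Mapping.keys q"] lookup_add algebra_simps
        single_add sum.distrib)
qed

lemma bilin_add_right: "bilin f p (q + q') = bilin f p q + bilin f p q'"
proof -
  let ?F = "Poly_Mapping.keys q \<union> Poly_Mapping.keys q'"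
  have "Poly_Mapping.keys (q + q') \<subseteq> ?F" by (rule keys_add)
  then show ?thesis
    by (simp add: bilin_superset[of "Poly_Mapping.keys p" ?F] lookup_add algebra_simps
        single_add sum.distrib)
qed

lemma bilin_single:
  "bilin f (Poly_Mapping.single a c) (Poly_Mapping.single b d) = Poly_Mapping.single (f a b) (c * d)"
  by (subst bilin_superset[of "{a}" "{b}"]) simp_all

lemma bilin_zero [simp]: "bilin f 0 q = 0" "bilin f p 0 = 0"
  by (simp_all add: bilin_def)

lemma pmul_bilin: "pmul = bilin (\<lambda>a b. (fst a + fst b, snd a @ snd b))"
  by (intro ext) (simp add: pmul_def bilin_def)

lemma mmul_bilin: "mmul = bilin (\<lambda>a b. (fst a + fst b, MNd (snd a) (snd b)))"
  by (intro ext) (simp add: mmul_def bilin_def)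

lemma pmul_add_left: "pmul (p + p') q = pmul p q + pmul p' q"
  by (simp add: pmul_bilin bilin_add_left)

lemma pmul_add_right: "pmul p (q + q') = pmul p q + pmul p q'"
  by (simp add: pmul_bilin bilin_add_right)

lemma pmul_zero [simp]: "pmul 0 q = 0" "pmul p 0 = 0"
  by (simp_all add: pmul_bilin)

lemma pmul_single:
  "pmul (Poly_Mapping.single a c) (Poly_Mapping.single b d)
   = Poly_Mapping.single (fst a + fst b, snd a @ snd b) (c * d)"
  by (simp add: pmul_bilin bilin_single)

lemma pmul_assoc: "pmul (pmul p q) r = pmul p (pmul q r)"
proof (induction p rule: poly_mapping_add_induct)
  case (single a c)
  show ?case
  proof (induction q rule: poly_mapping_add_induct)
    case (single b d)
    show ?case
      by (induction r rule: poly_mapping_add_induct)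
        (simp_all add: pmul_single pmul_add_right algebra_simps)
  qed (simp_all add: pmul_add_left pmul_add_right)
qed (simp_all add: pmul_add_left)

lemma pmul_diff_left: "pmul (p - p') q = pmul p q - pmul p' q"
  by (metis pmul_add_left add_diff_cancel diff_add_cancel)

lemma pmul_diff_right: "pmul p (q - q') = pmul p q - pmul p q'"
  by (metis pmul_add_right add_diff_cancel diff_add_cancel)

lemma embedY_eq_bilin:
  "embedY r = bilin (\<lambda>b u. (b, [])) r (Poly_Mapping.single () 1)"
  by (simp add: embedY_def bilin_def)

lemma embedY_add: "embedY (r + s) = embedY r + embedY s"
  by (simp add: embedY_eq_bilin bilin_add_left)

lemma embedY_zero [simp]: "embedY 0 = 0"
  by (simp add: embedY_def)

lemma embedY_single: "embedY (Poly_Mapping.single b c) = Poly_Mapping.single (b, []) c"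
  by (simp add: embedY_eq_bilin bilin_single)

lemma embedY_mult: "embedY (r * s) = pmul (embedY r) (embedY s)"
proof (induction r rule: poly_mapping_add_induct)
  case (single a c)
  show ?case
    by (induction s rule: poly_mapping_add_induct)
      (simp_all add: mult_single embedY_single pmul_single distrib_left embedY_add pmul_add_right)
qed (simp_all add: distrib_right embedY_add pmul_add_left)

lemma embedY_commute: "pmul (embedY r) p = pmul p (embedY r)"
proof (induction r rule: poly_mapping_add_induct)
  case (single a c)
  show ?case
    by (induction p rule: poly_mapping_add_induct)
      (simp_all add: embedY_single pmul_single pmul_add_left pmul_add_right algebra_simps)
qed (simp_all add: embedY_add pmul_add_left pmul_add_right)

text \<open>Scalars are taken in \<open>A = k[Y]\<close>, as the ring type \<^typ>\<open>('y \<Rightarrow>\<^sub>0 nat) \<Rightarrow>\<^sub>0 'k\<close>.\<close>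

definition smul :: "(('y \<Rightarrow>\<^sub>0 nat) \<Rightarrow>\<^sub>0 'k::comm_ring_1) \<Rightarrow> ('x, 'y, 'k) kpoly \<Rightarrow> ('x, 'y, 'k) kpoly" where
  "smul r p = pmul (embedY r) p"

lemma smul_single_single:
  "smul (Poly_Mapping.single b c) (Poly_Mapping.single m d)
   = Poly_Mapping.single (b + fst m, snd m) (c * d)"
  by (simp add: smul_def embedY_single pmul_single)

lemma smul_pmul_left: "pmul (smul r p) q = smul r (pmul p q)"
  by (simp add: smul_def pmul_assoc)

lemma smul_pmul_right: "pmul p (smul r q) = smul r (pmul p q)"
  by (metis smul_def pmul_assoc embedY_commute)

interpretation A: module "smul :: _ \<Rightarrow> ('x, 'y, 'k::comm_ring_1) kpoly \<Rightarrow> _"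
proof
  fix a b :: "('y \<Rightarrow>\<^sub>0 nat) \<Rightarrow>\<^sub>0 'k" and x y :: "('x, 'y, 'k) kpoly"
  show "smul a (x + y) = smul a x + smul a y" by (simp add: smul_def pmul_add_right)
  show "smul (a + b) x = smul a x + smul b x" by (simp add: smul_def embedY_add pmul_add_left)
  show "smul a (smul b x) = smul (a * b) x" by (simp add: smul_def embedY_mult pmul_assoc)
  have "smul (Poly_Mapping.single 0 1) x = x"
    by (induction x rule: poly_mapping_add_induct)
      (simp_all add: smul_def embedY_single pmul_single pmul_add_right del: single_one)
  then show "smul 1 x = x" by simp
qed

section \<open>Polynomials as combinations of words over \<open>k[Y]\<close>\<close>

definition mon :: "'x list \<Rightarrow> ('x, 'y, 'k::comm_ring_1) kpoly" where
  "mon w = Poly_Mapping.single (0, w) 1"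

lemma pmul_mon_mon: "pmul (mon u) (mon v) = mon (u @ v)"
  by (simp add: mon_def pmul_single)

lemma Xg_mon: "Xg x = mon [x]"
  by (simp add: Xg_def mon_def)

lemma pmul_mon_Nil [simp]: "pmul (mon []) p = p" "pmul p (mon []) = p"
proof -
  have m: "mon [] = embedY 1"
    by (metis mon_def embedY_single single_one)
  show 1: "pmul (mon []) p = p" using A.scale_one[of p] unfolding m smul_def .
  then show "pmul p (mon []) = p" unfolding m by (simp add: embedY_commute)
qed

text \<open>Regroups the pairs by their word, which presents the algebra as the free
  \<open>k[Y]\<close>-module on words.\<close>

definition cf :: "('x, 'y, 'k::comm_ring_1) kpoly \<Rightarrow> 'x list \<Rightarrow> (('y \<Rightarrow>\<^sub>0 nat) \<Rightarrow>\<^sub>0 'k)" where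
  "cf p w = Poly_Mapping.Abs_poly_mapping (\<lambda>b. Poly_Mapping.lookup p (b, w))"

lemma lookup_cf: "Poly_Mapping.lookup (cf p w) b = Poly_Mapping.lookup p (b, w)"
proof -
  have "finite (fst ` Poly_Mapping.keys p)" by simp
  then have "finite {b. Poly_Mapping.lookup p (b, w) \<noteq> 0}"
    by (rule rev_finite_subset) (force simp: in_keys_iff)
  then show ?thesis by (simp add: cf_def)
qed

lemma cf_zero [simp]: "cf 0 w = 0"
  by (rule poly_mapping_eqI) (simp add: lookup_cf)

lemma cf_add: "cf (p + q) w = cf p w + cf q w"
  by (rule poly_mapping_eqI) (simp add: lookup_cf lookup_add)

lemma cf_diff: "cf (p - q) w = cf p w - cf q w"
  by (rule poly_mapping_eqI) (simp add: lookup_cf lookup_minus)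

lemma cf_single: "cf (Poly_Mapping.single m c) w = (if snd m = w then Poly_Mapping.single (fst m) c else 0)"
  by (rule poly_mapping_eqI) (auto simp: lookup_cf lookup_single when_def)

lemma cf_sum: "cf (sum f F) w = (\<Sum>i\<in>F. cf (f i) w)"
  by (induction F rule: infinite_finite_induct) (simp_all add: cf_add)

lemma cf_smul: "cf (smul r p) w = r * cf p w"
proof (induction r rule: poly_mapping_add_induct)
  case (single b c)
  show ?case
    by (induction p rule: poly_mapping_add_induct)
      (simp_all add: smul_single_single cf_single mult_single A.scale_right_distrib cf_add distrib_left)
qed (simp_all add: A.scale_left_distrib cf_add distrib_right)

lemma cf_mon: "cf (mon v) w = (if v = w then 1 else 0)"
  by (simp add: mon_def cf_single)

lemma kpoly_eqI: "(\<And>w. cf p w = cf q w) \<Longrightarrow> p = q"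
  by (rule poly_mapping_eqI) (metis lookup_cf prod.exhaust)

lemma finite_cf: "finite {w. cf p w \<noteq> 0}"
proof (rule finite_subset)
  show "{w. cf p w \<noteq> 0} \<subseteq> snd ` Poly_Mapping.keys p"
  proof
    fix w assume "w \<in> {w. cf p w \<noteq> 0}"
    then obtain b where "Poly_Mapping.lookup (cf p w) b \<noteq> 0"
      by (metis (mono_tags) mem_Collect_eq lookup_zero poly_mapping_eqI)
    then have "(b, w) \<in> Poly_Mapping.keys p" by (simp add: lookup_cf in_keys_iff)
    then show "w \<in> snd ` Poly_Mapping.keys p" by force
  qed
qed simp

lemma kpoly_expand:
  assumes "finite F" "{w. cf p w \<noteq> 0} \<subseteq> F"
  shows "p = (\<Sum>w\<in>F. smul (cf p w) (mon w))"
proof (rule kpoly_eqI)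
  fix v
  have "cf (\<Sum>w\<in>F. smul (cf p w) (mon w)) v = (\<Sum>w\<in>F. if w = v then cf p w else 0)"
    by (auto simp: cf_sum cf_smul cf_mon intro: sum.cong)
  also have "\<dots> = cf p v" using assms by (auto simp: sum.delta)
  finally show "cf p v = cf (\<Sum>w\<in>F. smul (cf p w) (mon w)) v" by simp
qed

lemma span_mon: "A.span (mon ` W) = {p. \<forall>w. cf p w \<noteq> 0 \<longrightarrow> w \<in> W}"
proof (intro set_eqI iffI)
  fix p assume "p \<in> A.span (mon ` W)"
  then have "\<forall>w. w \<notin> W \<longrightarrow> cf p w = 0"
  proof (induction rule: A.span_induct_alt)
    case (step c x y)
    then show ?case by (auto simp: cf_add cf_smul cf_mon)
  qed simp
  then show "p \<in> {p. \<forall>w. cf p w \<noteq> 0 \<longrightarrow> w \<in> W}" by blast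
next
  fix p assume p: "p \<in> {p. \<forall>w. cf p w \<noteq> 0 \<longrightarrow> w \<in> W}"
  have "(\<Sum>w\<in>{w. cf p w \<noteq> 0}. smul (cf p w) (mon w)) \<in> A.span (mon ` W)"
    using p by (intro A.span_sum A.span_scale A.span_base) auto
  then show "p \<in> A.span (mon ` W)"
    using kpoly_expand[OF finite_cf order_refl, of p] by simp
qed

lemma pmul_span:
  assumes "\<And>g h. g \<in> G \<Longrightarrow> h \<in> H \<Longrightarrow> pmul g h \<in> A.span K" "p \<in> A.span G" "q \<in> A.span H"
  shows "pmul p q \<in> A.span K"
  using assms(2)
proof (induction rule: A.span_induct_alt)
  case (step c x y)
  have "pmul x q \<in> A.span K" using assms(3)
  proof (induction rule: A.span_induct_alt)
    case (step d z w)
    then show ?case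
      using assms(1) \<open>x \<in> G\<close> by (simp add: pmul_add_right smul_pmul_right A.span_add A.span_scale)
  qed (simp add: A.span_zero)
  then show ?case
    using step by (simp add: pmul_add_left smul_pmul_left A.span_add A.span_scale)
qed (simp add: A.span_zero)

lemma bracket_add_left: "bracket (p + p') q = bracket p q + bracket p' q"
  by (simp add: bracket_def pmul_add_left pmul_add_right)

lemma bracket_add_right: "bracket p (q + q') = bracket p q + bracket p q'"
  by (simp add: bracket_def pmul_add_left pmul_add_right)

lemma bracket_smul_left: "bracket (smul r p) q = smul r (bracket p q)"
  by (simp add: bracket_def smul_pmul_left smul_pmul_right A.scale_right_diff_distrib)

lemma bracket_smul_right: "bracket p (smul r q) = smul r (bracket p q)"
  by (simp add: bracket_def smul_pmul_left smul_pmul_right A.scale_right_diff_distrib)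

lemma bracket_zero [simp]: "bracket 0 q = 0" "bracket p 0 = 0"
  by (simp_all add: bracket_def)

lemma bracket_self: "bracket p p = 0"
  by (simp add: bracket_def)

lemma bracket_jacobi:
  "bracket (bracket p q) r + bracket (bracket q r) p + bracket (bracket r p) q = 0"
  by (simp add: bracket_def pmul_diff_left pmul_diff_right pmul_assoc)

section \<open>The free nonassociative algebra and its evaluation by commutators\<close>

lemma mmul_add_left: "mmul (p + p') q = mmul p q + mmul p' q"
  by (simp add: mmul_bilin bilin_add_left)

lemma mmul_add_right: "mmul p (q + q') = mmul p q + mmul p q'"
  by (simp add: mmul_bilin bilin_add_right)

lemma mmul_zero [simp]: "mmul 0 q = 0" "mmul p 0 = 0"
  by (simp_all add: mmul_bilin)

lemma mmul_single:
  "mmul (Poly_Mapping.single a c) (Poly_Mapping.single b d)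
   = Poly_Mapping.single (fst a + fst b, MNd (snd a) (snd b)) (c * d)"
  by (simp add: mmul_bilin bilin_single)

lemma mscale_bilin: "mscale c b p = bilin (\<lambda>b a. (b + fst a, snd a)) (Poly_Mapping.single b c) p"
proof -
  have "bilin (\<lambda>b a. (b + fst a, snd a)) (Poly_Mapping.single b c) p
    = (\<Sum>a\<in>{b}. \<Sum>m\<in>Poly_Mapping.keys p. Poly_Mapping.single (a + fst m, snd m)
         (Poly_Mapping.lookup (Poly_Mapping.single b c) a * Poly_Mapping.lookup p m))"
    by (rule bilin_superset) simp_all
  then show ?thesis by (simp add: mscale_def)
qed

lemma mY_bilin: "mY = bilin (\<lambda>b a. (b + fst a, snd a))"
proof (intro ext)
  fix r :: "('a \<Rightarrow>\<^sub>0 nat) \<Rightarrow>\<^sub>0 'b" and p :: "('c, 'a, 'b) mpoly"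
  show "mY r p = bilin (\<lambda>b a. (b + fst a, snd a)) r p"
    by (simp add: mY_def mscale_def bilin_def)
qed

lemma mscale_eq_mY: "mscale c b p = mY (Poly_Mapping.single b c) p"
  by (simp add: mscale_bilin mY_bilin)

lemma mY_single:
  "mY (Poly_Mapping.single b c) (Poly_Mapping.single m d)
   = Poly_Mapping.single (b + fst m, snd m) (c * d)"
  by (simp add: mY_bilin bilin_single)

interpretation M: module "mY :: _ \<Rightarrow> ('x, 'y, 'k::comm_ring_1) mpoly \<Rightarrow> _"
proof
  fix a b :: "('y \<Rightarrow>\<^sub>0 nat) \<Rightarrow>\<^sub>0 'k" and x y :: "('x, 'y, 'k) mpoly"
  show r: "mY a (x + y) = mY a x + mY a y" for a x y by (simp add: mY_bilin bilin_add_right)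
  show l: "mY (a + b) x = mY a x + mY b x" for a b x by (simp add: mY_bilin bilin_add_left)
  have z: "mY 0 x = 0" "mY a 0 = 0" for a x by (simp_all add: mY_bilin)
  show "mY a (mY b x) = mY (a * b) x"
  proof (induction a rule: poly_mapping_add_induct)
    case (single i c)
    show ?case
    proof (induction b rule: poly_mapping_add_induct)
      case (single j d)
      show ?case
        by (induction x rule: poly_mapping_add_induct)
          (simp_all add: mY_single mult_single r z algebra_simps)
    qed (simp_all add: r l z distrib_left)
  qed (simp_all add: r l z distrib_right)
  have "mY (Poly_Mapping.single 0 1) x = x"
    by (induction x rule: poly_mapping_add_induct) (simp_all add: mY_single r z del: single_one)
  then show "mY 1 x = x" by simp
qed

lemma mmul_mY_left: "mmul (mY r p) q = mY r (mmul p q)"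
proof (induction r rule: poly_mapping_add_induct)
  case (single i c)
  show ?case
  proof (induction p rule: poly_mapping_add_induct)
    case (single j d)
    show ?case
      by (induction q rule: poly_mapping_add_induct)
        (simp_all add: mY_single mmul_single mmul_add_right M.scale_right_distrib algebra_simps)
  qed (simp_all add: mmul_add_left M.scale_right_distrib)
qed (simp_all add: mmul_add_left M.scale_left_distrib)

lemma mmul_mY_right: "mmul p (mY r q) = mY r (mmul p q)"
proof (induction r rule: poly_mapping_add_induct)
  case (single i c)
  show ?case
  proof (induction p rule: poly_mapping_add_induct)
    case (single j d)
    show ?case
      by (induction q rule: poly_mapping_add_induct)
        (simp_all add: mY_single mmul_single mmul_add_right M.scale_right_distrib algebra_simps)
  qed (simp_all add: mmul_add_left M.scale_right_distrib)
qed (simp_all add: mmul_add_right M.scale_left_distrib)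

lemma mev_superset:
  assumes "finite F" "Poly_Mapping.keys p \<subseteq> F"
  shows "mev p = (\<Sum>a\<in>F. pmul (Poly_Mapping.single (fst a, []) (Poly_Mapping.lookup p a)) (mtev (snd a)))"
  unfolding mev_def using assms by (intro sum.mono_neutral_left) (auto simp: in_keys_iff)

lemma mev_single: "mev (Poly_Mapping.single m c) = smul (Poly_Mapping.single (fst m) c) (mtev (snd m))"
  by (subst mev_superset[of "{m}"]) (simp_all add: smul_def embedY_single)

lemma mev_add: "mev (p + q) = mev p + mev q"
proof -
  let ?F = "Poly_Mapping.keys p \<union> Poly_Mapping.keys q"
  have "Poly_Mapping.keys (p + q) \<subseteq> ?F" by (rule keys_add)
  then show ?thesis
    by (simp add: mev_superset[of ?F] lookup_add single_add pmul_add_left sum.distrib)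
qed

lemma mev_zero [simp]: "mev 0 = 0"
  by (simp add: mev_def)

lemma mev_mY: "mev (mY r p) = smul r (mev p)"
proof (induction r rule: poly_mapping_add_induct)
  case (single i c)
  show ?case
    by (induction p rule: poly_mapping_add_induct)
      (simp_all add: mY_single mev_single mult_single M.scale_right_distrib A.scale_right_distrib mev_add)
qed (simp_all add: M.scale_left_distrib A.scale_left_distrib mev_add)

lemma mev_mmul: "mev (mmul p q) = bracket (mev p) (mev q)"
proof (induction p rule: poly_mapping_add_induct)
  case (single i c)
  show ?case
    by (induction q rule: poly_mapping_add_induct)
      (simp_all add: mmul_single mev_single bracket_smul_left bracket_smul_right mult_single
        mmul_add_right mev_add bracket_add_right add.commute mult.commute)
qed (simp_all add: mmul_add_left mev_add bracket_add_left)

interpretation mev: module_hom mY smul mev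
  by unfold_locales (simp_all add: mev_add mev_mY)

section \<open>Leading terms of normal s-words\<close>

definition sword :: "'x list \<Rightarrow> ('x, 'y, 'k::comm_ring_1) kpoly \<Rightarrow> 'x list \<Rightarrow> ('x, 'y, 'k) kpoly" where
  "sword a s b = pmul (mon a) (pmul s (mon b))"

lemma sword_Nil [simp]: "sword [] s [] = s"
  by (simp add: sword_def)

lemma pmul_mon_sword: "pmul (mon c) (sword a s b) = sword (c @ a) s b"
  by (simp add: sword_def pmul_assoc[symmetric] pmul_mon_mon)

lemma pmul_sword_mon: "pmul (sword a s b) (mon c) = sword a s (b @ c)"
  by (simp add: sword_def pmul_assoc pmul_mon_mon)

lemma sword_sword: "sword a (sword a' s b') b = sword (a @ a') s (b' @ b)"
  by (simp add: sword_def[of a] pmul_mon_sword pmul_sword_mon)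

lemma sword_diff: "sword a (p - q) b = sword a p b - sword a q b"
  by (simp add: sword_def pmul_diff_left pmul_diff_right)

lemma sword_mon: "sword a (mon u) b = mon (a @ u @ b)"
  by (simp add: sword_def pmul_mon_mon)

lemma sword_mon_Nil [simp]: "sword a (mon []) b = mon (a @ b)"
  by (simp add: sword_mon)

text \<open>The set \<open>G\<close> consists of polynomials paired with their leading words.\<close>

definition wspan ::
    "(('x, 'y, 'k::comm_ring_1) kpoly \<times> 'x list) set \<Rightarrow> 'x list set \<Rightarrow> ('x, 'y, 'k) kpoly set" where
  "wspan G W = A.span {sword a s b | a s u b. (s, u) \<in> G \<and> a @ u @ b \<in> W}"

lemma wspan_mono: "G \<subseteq> H \<Longrightarrow> V \<subseteq> W \<Longrightarrow> wspan G V \<subseteq> wspan H W"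
  unfolding wspan_def by (rule A.span_mono) blast

lemma sword_in_wspan: "(s, u) \<in> G \<Longrightarrow> a @ u @ b \<in> W \<Longrightarrow> sword a s b \<in> wspan G W"
  unfolding wspan_def by (rule A.span_base) blast

lemma wspan_add: "p \<in> wspan G W \<Longrightarrow> q \<in> wspan G W \<Longrightarrow> p + q \<in> wspan G W"
  and wspan_diff: "p \<in> wspan G W \<Longrightarrow> q \<in> wspan G W \<Longrightarrow> p - q \<in> wspan G W"
  and wspan_smul: "p \<in> wspan G W \<Longrightarrow> smul r p \<in> wspan G W"
  and wspan_zero [simp]: "0 \<in> wspan G W"
  unfolding wspan_def by (simp_all add: A.span_add A.span_diff A.span_zero A.span_scale)

text \<open>The s-words of \<open>s = 1\<close> are the plain words, so polynomials with prescribed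
  support, and their leading words, are a special case of the same machinery.\<close>

abbreviation one_gen :: "(('x, 'y, 'k::comm_ring_1) kpoly \<times> 'x list) set" where
  "one_gen \<equiv> {(mon [], [])}"

lemma wspan_one_gen:
  fixes W :: "'x list set"
  shows "wspan one_gen W = {p :: ('x, 'y, 'k::comm_ring_1) kpoly. \<forall>v. cf p v \<noteq> 0 \<longrightarrow> v \<in> W}"
proof -
  have eq: "{sword a s b | a s u b. (s, u) \<in> one_gen \<and> a @ u @ b \<in> W}
      = (mon ` W :: ('x, 'y, 'k) kpoly set)"
    by (auto simp: image_iff) (metis append_Nil)
  show ?thesis unfolding wspan_def eq by (rule span_mon)
qed

lemma mon_in_wspan: "v \<in> V \<Longrightarrow> mon v \<in> wspan one_gen V"
  using sword_in_wspan[of "mon []" "[]" one_gen v "[]" V] by simp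

lemma pmul_wspan_right:
  fixes p q :: "('x, 'y, 'k::comm_ring_1) kpoly"
  assumes "p \<in> wspan G W" "q \<in> wspan one_gen V" "\<And>w v. w \<in> W \<Longrightarrow> v \<in> V \<Longrightarrow> w @ v \<in> Z"
  shows "pmul p q \<in> wspan G Z"
  unfolding wspan_def
proof (rule pmul_span[OF _ assms(1,2)[unfolded wspan_def]])
  fix g h :: "('x, 'y, 'k) kpoly"
  assume "g \<in> {sword a s b |a s u b. (s, u) \<in> G \<and> a @ u @ b \<in> W}"
    and "h \<in> {sword a s b |a s u b. (s, u) \<in> one_gen \<and> a @ u @ b \<in> V}"
  then obtain a s u b c e where g: "g = sword a s b" "(s, u) \<in> G" "a @ u @ b \<in> W"
    and h: "h = mon (c @ e)" "c @ e \<in> V" by auto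
  have "sword a s (b @ c @ e) \<in> wspan G Z"
    by (rule sword_in_wspan[OF g(2)]) (use assms(3)[OF g(3) h(2)] in simp)
  then show "pmul g h \<in> A.span {sword a s b |a s u b. (s, u) \<in> G \<and> a @ u @ b \<in> Z}"
    using g h by (simp add: pmul_sword_mon wspan_def)
qed

lemma pmul_wspan_left:
  fixes p q :: "('x, 'y, 'k::comm_ring_1) kpoly"
  assumes "q \<in> wspan one_gen V" "p \<in> wspan G W" "\<And>w v. w \<in> W \<Longrightarrow> v \<in> V \<Longrightarrow> v @ w \<in> Z"
  shows "pmul q p \<in> wspan G Z"
  unfolding wspan_def
proof (rule pmul_span[OF _ assms(1,2)[unfolded wspan_def]])
  fix h g :: "('x, 'y, 'k) kpoly"
  assume "g \<in> {sword a s b |a s u b. (s, u) \<in> G \<and> a @ u @ b \<in> W}"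
    and "h \<in> {sword a s b |a s u b. (s, u) \<in> one_gen \<and> a @ u @ b \<in> V}"
  then obtain a s u b c e where g: "g = sword a s b" "(s, u) \<in> G" "a @ u @ b \<in> W"
    and h: "h = mon (c @ e)" "c @ e \<in> V" by auto
  have "sword ((c @ e) @ a) s b \<in> wspan G Z"
    by (rule sword_in_wspan[OF g(2)]) (use assms(3)[OF g(3) h(2)] in simp)
  then show "pmul h g \<in> A.span {sword a s b |a s u b. (s, u) \<in> G \<and> a @ u @ b \<in> Z}"
    using g h by (simp add: pmul_mon_sword wspan_def)
qed

abbreviation below :: "'x::linorder list \<Rightarrow> 'x list set" where
  "below w \<equiv> {v. deglexX w v}"

lemma sword_wspan: "p \<in> wspan G (below w) \<Longrightarrow> sword a p b \<in> wspan G (below (a @ w @ b))"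
  unfolding sword_def
  by (rule pmul_wspan_left[OF mon_in_wspan[of a "{a}"]], simp,
      rule pmul_wspan_right[OF _ mon_in_wspan[of b "{b}"], of _ _ "below w" "below (w @ b)"]) auto

lemma deglexX_append_mono:
  assumes "v \<in> insert w (below w)" "v' \<in> insert w' (below w')"
  shows "v @ v' \<in> insert (w @ w') (below (w @ w'))"
    and "deglexX w v \<or> deglexX w' v' \<Longrightarrow> deglexX (w @ w') (v @ v')"
proof -
  have "w @ w' = w @ v' \<or> deglexX (w @ w') (w @ v')" "w @ v' = v @ v' \<or> deglexX (w @ v') (v @ v')"
    using assms by auto
  then have *: "w @ w' = v @ v' \<or> deglexX (w @ w') (v @ v')"
    using deglexX_trans[of "w @ w'" "w @ v'" "v @ v'"] by auto
  then show "v @ v' \<in> insert (w @ w') (below (w @ w'))" by auto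
  assume d: "deglexX w v \<or> deglexX w' v'"
  \<comment> \<open>Neither factor is longer than its counterpart, so equal products split at the
    same place; then both factors agree, against \<open>d\<close>.\<close>
  have "length w = length v" if "w @ w' = v @ v'"
  proof -
    have "length v \<le> length w" "length v' \<le> length w'" using assms by (auto simp: deglexX_def)
    moreover have "length w + length w' = length v + length v'"
      using arg_cong[OF that, of length] by simp
    ultimately show ?thesis by simp
  qed
  then have "w @ w' \<noteq> v @ v'" using d by auto
  with * show "deglexX (w @ w') (v @ v')" by simp
qed

text \<open>\<open>nrm s u a b P\<close>: when \<open>u\<close> is the leading word of \<open>s\<close>, the leading \<open>s\<close>-word of \<open>P\<close> is \<open>a s b\<close>.
  With \<open>s = 1\<close> this says that \<open>P\<close> is monic with leading word \<open>ab\<close>.\<close>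

definition nrm :: "('x::linorder, 'y, 'k::comm_ring_1) kpoly \<Rightarrow> 'x list \<Rightarrow> 'x list \<Rightarrow> 'x list \<Rightarrow> ('x, 'y, 'k) kpoly \<Rightarrow> bool" where
  "nrm s u a b P \<longleftrightarrow> P - sword a s b \<in> wspan {(s, u)} (below (a @ u @ b))"

definition lead :: "('x::linorder, 'y, 'k::comm_ring_1) kpoly \<Rightarrow> 'x list \<Rightarrow> bool" where
  "lead P w \<longleftrightarrow> P - mon w \<in> wspan one_gen (below w)"

lemma lead_iff_nrm: "lead P (a @ b) \<longleftrightarrow> nrm (mon []) [] a b P"
  by (simp add: lead_def nrm_def)

lemma lead_iff_cf: "lead P w \<longleftrightarrow> cf P w = 1 \<and> (\<forall>v. v \<noteq> w \<longrightarrow> cf P v \<noteq> 0 \<longrightarrow> deglexX w v)"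
  by (auto simp: lead_def wspan_one_gen cf_diff cf_mon)

lemma lead_mon: "lead (mon w) w"
  by (simp add: lead_def)

lemma nrm_wspan:
  assumes "nrm s u a b P"
  shows "P \<in> wspan {(s, u)} (insert (a @ u @ b) (below (a @ u @ b)))"
proof -
  let ?W = "insert (a @ u @ b) (below (a @ u @ b))"
  have "P - sword a s b \<in> wspan {(s, u)} ?W"
    using assms wspan_mono[of "{(s, u)}" "{(s, u)}" "below (a @ u @ b)" ?W] by (auto simp: nrm_def)
  from wspan_add[OF this sword_in_wspan[of s u "{(s, u)}" a b ?W]] show ?thesis by simp
qed

lemma lead_wspan: "lead P w \<Longrightarrow> P \<in> wspan one_gen (insert w (below w))"
  using nrm_wspan[of "mon []" "[]" w "[]" P] lead_iff_nrm[of P w "[]"] by simp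

text \<open>Of \<open>P Q\<close> and \<open>Q P\<close>, the one with the larger concatenated word
  supplies the leading s-word, and the other consists entirely of lower s-words. The error of a
  product is split into the error of \<open>P\<close> times \<open>Q\<close> and the leading s-word
  of \<open>P\<close> times the error of \<open>Q\<close> (in the matching order), which keeps every
  term a combination of s-words.\<close>

lemma nrm_bracket:
  assumes P: "nrm s u a b P" and Q: "lead Q q"
  shows "deglexX (a @ u @ b @ q) (q @ a @ u @ b) \<Longrightarrow> nrm s u a (b @ q) (bracket P Q)"
    and "deglexX (q @ a @ u @ b) (a @ u @ b @ q) \<Longrightarrow> nrm s u (q @ a) b (bracket Q P)"
proof -
  let ?G = "{(s, u)}" and ?w = "a @ u @ b"
  have P0: "P - sword a s b \<in> wspan ?G (below ?w)" using P by (simp add: nrm_def)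
  have Q0: "Q - mon q \<in> wspan one_gen (below q)" using Q by (simp add: lead_def)
  note P1 = nrm_wspan[OF P] and Q1 = lead_wspan[OF Q]
  have s: "sword a s b \<in> wspan ?G {?w}" by (rule sword_in_wspan) simp_all
  have "pmul P Q - sword a s (b @ q) = pmul (P - sword a s b) Q + pmul (sword a s b) (Q - mon q)"
    by (simp add: pmul_diff_left pmul_diff_right pmul_sword_mon)
  moreover have "pmul (P - sword a s b) Q \<in> wspan ?G (below (?w @ q))"
    by (rule pmul_wspan_right[OF P0 Q1]) (use deglexX_append_mono(2)[of _ ?w _ q] in auto)
  moreover have "pmul (sword a s b) (Q - mon q) \<in> wspan ?G (below (?w @ q))"
    by (rule pmul_wspan_right[OF s Q0]) auto
  ultimately have PQ: "pmul P Q - sword a s (b @ q) \<in> wspan ?G (below (?w @ q))"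
    using wspan_add by metis
  have "pmul Q P - sword (q @ a) s b = pmul Q (P - sword a s b) + pmul (Q - mon q) (sword a s b)"
    by (simp add: pmul_diff_left pmul_diff_right pmul_mon_sword)
  moreover have "pmul Q (P - sword a s b) \<in> wspan ?G (below (q @ ?w))"
    by (rule pmul_wspan_left[OF Q1 P0]) (use deglexX_append_mono(2)[of _ q _ ?w] in auto)
  moreover have "pmul (Q - mon q) (sword a s b) \<in> wspan ?G (below (q @ ?w))"
    by (rule pmul_wspan_left[OF Q0 s]) (use deglexX_append_mono(2)[of _ q _ ?w] in auto)
  ultimately have QP: "pmul Q P - sword (q @ a) s b \<in> wspan ?G (below (q @ ?w))"
    using wspan_add by metis
  show "nrm s u a (b @ q) (bracket P Q)" if d: "deglexX (a @ u @ b @ q) (q @ a @ u @ b)"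
  proof -
    have "pmul Q P \<in> wspan ?G (below (?w @ q))"
    proof (rule pmul_wspan_left[OF Q1 P1])
      fix v v' assume "v \<in> insert ?w (below ?w)" "v' \<in> insert q (below q)"
      from deglexX_append_mono(1)[OF this(2,1)] d show "v' @ v \<in> below (?w @ q)"
        using deglexX_trans[of "?w @ q" "q @ ?w" "v' @ v"] by auto
    qed
    from wspan_diff[OF PQ this] show ?thesis
      by (simp add: nrm_def bracket_def algebra_simps)
  qed
  show "nrm s u (q @ a) b (bracket Q P)" if d: "deglexX (q @ a @ u @ b) (a @ u @ b @ q)"
  proof -
    have "pmul P Q \<in> wspan ?G (below (q @ ?w))"
    proof (rule pmul_wspan_right[OF P1 Q1])
      fix v v' assume "v \<in> insert ?w (below ?w)" "v' \<in> insert q (below q)"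
      from deglexX_append_mono(1)[OF this] d show "v @ v' \<in> below (q @ ?w)"
        using deglexX_trans[of "q @ ?w" "?w @ q" "v @ v'"] by auto
    qed
    from wspan_diff[OF QP this] show ?thesis
      by (simp add: nrm_def bracket_def algebra_simps)
  qed
qed

lemma ALSW_deglexX_rotate:
  "ALSW (u @ v) \<Longrightarrow> u \<noteq> [] \<Longrightarrow> v \<noteq> [] \<Longrightarrow> deglexX (u @ v) (v @ u)"
  using ALSW_rotate by (simp add: deglexX_def)

lemma lead_bracket:
  assumes "lead P p" "lead Q q" "deglexX (p @ q) (q @ p)"
  shows "lead (bracket P Q) (p @ q)"
proof -
  have "nrm (mon []) [] p [] P" using assms(1) lead_iff_nrm[of P p "[]"] by simp
  from nrm_bracket(1)[OF this assms(2)] show ?thesis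
    using assms(3) lead_iff_nrm[of "bracket P Q" p q] by simp
qed

section \<open>Standard and special bracketings\<close>

lemma std_tree_aux_fuel: "length w \<le> n \<Longrightarrow> std_tree_aux n w = std_tree w"
proof (induction "length w" arbitrary: w n rule: less_induct)
  case less
  show ?case
  proof (cases "2 \<le> length w")
    case False
    then show ?thesis
      using less.prems by (cases n; cases w) (auto simp: std_tree_def split: list.split)
  next
    case True
    then obtain x y ys where w: "w = x # y # ys" by (cases w; cases "tl w") auto
    have c: "0 < std_cut w" "std_cut w < length w" using std_cut[OF True] by auto
    have aux: "std_tree_aux m w = Nd (std_tree (take (std_cut w) w)) (std_tree (drop (std_cut w) w))"
      if m: "length w \<le> m" for m
    proof -
      obtain k where k: "m = Suc k" using m w by (cases m) auto
      have "std_tree_aux m w = Nd (std_tree_aux k (take (std_cut w) w)) (std_tree_aux k (drop (std_cut w) w))"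
        unfolding k std_cut_def by (simp add: w Let_def)
      moreover have "std_tree_aux k (take (std_cut w) w) = std_tree (take (std_cut w) w)"
        by (rule less.hyps) (use c m k in auto)
      moreover have "std_tree_aux k (drop (std_cut w) w) = std_tree (drop (std_cut w) w)"
        by (rule less.hyps) (use c m k in auto)
      ultimately show ?thesis by simp
    qed
    show ?thesis using aux[OF less.prems] aux[of "length w"] by (simp add: std_tree_def)
  qed
qed

lemma std_tree_Nd:
  assumes "2 \<le> length w"
  shows "std_tree w = Nd (std_tree (take (std_cut w) w)) (std_tree (drop (std_cut w) w))"
proof -
  obtain x y ys where w: "w = x # y # ys" using assms by (cases w; cases "tl w") auto
  have c: "0 < std_cut w" "std_cut w < length w" using std_cut[OF assms] by auto
  have "std_tree_aux (Suc (length w)) w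
      = Nd (std_tree_aux (length w) (take (std_cut w) w)) (std_tree_aux (length w) (drop (std_cut w) w))"
    unfolding std_tree_aux.simps(2) std_cut_def by (simp add: w Let_def)
  then show ?thesis by (simp add: std_tree_aux_fuel del: std_tree_aux.simps)
qed

lemma std_tree_single: "std_tree [x] = Lf x"
  by (simp add: std_tree_def)

lemma ALSW_std_induct [consumes 1, case_names single split]:
  assumes "ALSW w"
    and "\<And>x. P [x]"
    and "\<And>u v. ALSW u \<Longrightarrow> ALSW v \<Longrightarrow> ALSW (u @ v) \<Longrightarrow> std_cut (u @ v) = length u \<Longrightarrow>
           std_tree (u @ v) = Nd (std_tree u) (std_tree v) \<Longrightarrow> P u \<Longrightarrow> P v \<Longrightarrow> P (u @ v)"
  shows "P w"
  using assms(1)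
proof (induction "length w" arbitrary: w rule: less_induct)
  case less
  show ?case
  proof (cases "2 \<le> length w")
    case False
    then obtain x where "w = [x]" using ALSW_not_Nil[OF less.prems]
      by (cases w) (auto simp: not_le)
    then show ?thesis using assms(2) by simp
  next
    case True
    let ?u = "take (std_cut w) w" and ?v = "drop (std_cut w) w"
    note c = std_cut[OF True]
    have "P (?u @ ?v)"
    proof (rule assms(3))
      show u: "ALSW ?u" using ALSW_std_left[OF less.prems True] .
      show "P ?u" by (rule less.hyps) (use c u in auto)
      show "P ?v" by (rule less.hyps) (use c in auto)
    qed (use c std_tree_Nd[OF True] less.prems in auto)
    then show ?thesis by simp
  qed
qed

lemma tword_std_tree: "ALSW w \<Longrightarrow> tword (std_tree w) = w"
  by (induction w rule: ALSW_std_induct) (simp_all add: std_tree_single)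

lemma tev_std_tree: "ALSW w \<Longrightarrow> tev s (std_tree w) = brk w"
  by (induction w rule: ALSW_std_induct) (simp_all add: std_tree_single brk_def)

text \<open>At each node the top words of the two products are \<open>u @ v\<close> and
  \<open>v @ u\<close>, and an ALSW exceeds its rotations, so the leading coefficient stays
  \<open>1\<close>.\<close>

lemma lead_brk: "ALSW w \<Longrightarrow> lead (brk w) w"
proof (induction w rule: ALSW_std_induct)
  case (single x)
  show ?case by (simp add: brk_def std_tree_single Xg_mon lead_mon)
next
  case (split u v)
  then have "brk (u @ v) = bracket (brk u) (brk v)" by (simp add: brk_def)
  then show ?case
    using split lead_bracket ALSW_deglexX_rotate ALSW_not_Nil by metis
qed

text \<open>Bracketing with the next factor extends the leading s-word to the right as long as the
  words obtained stay ALSW. They do: \<open>u @ c\<close> exceeds its last factor, a proper suffix,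
  hence every factor, and a prefix of \<open>u @ c\<close> exceeds them all the more, so
  \<open>ALSW_append\<close> applies.\<close>

lemma nrm_special_top:
  fixes s :: "('x::linorder, 'y, 'k::comm_ring_1) kpoly"
  assumes u: "ALSW u" and uc: "ALSW (u @ c)"
  shows "nrm s u [] c (tev s (foldl Nd Hole (map std_tree (alsw_fact c))))"
proof -
  let ?cs = "alsw_fact c"
  have cs: "concat ?cs = c" "\<forall>d\<in>set ?cs. ALSW d" "sorted_wrt alsw_le ?cs"
    using alsw_fact[of c] by (auto simp: alsw_facts_def)
  have gt: "lexgt (u @ c) d" if d: "d \<in> set ?cs" for d
  proof -
    obtain es e where es: "?cs = es @ [e]" using d by (cases ?cs rule: rev_cases) auto
    have e: "c = concat es @ e" "ALSW e" using cs es by (metis concat_append concat.simps append_Nil2) (use cs es in auto)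
    then have "lexgt (u @ c) e"
      using ALSW_gt_suffix[of "u @ concat es" e] uc ALSW_not_Nil[OF u] ALSW_not_Nil[OF e(2)] by simp
    moreover have "d = e \<or> lexgt e d"
      using d cs(3) unfolding es by (auto simp: sorted_wrt_append alsw_le_def)
    ultimately show ?thesis using lexgt_trans by blast
  qed
  have "ALSW (u @ concat ds) \<and> nrm s u [] (concat ds) (tev s (foldl Nd Hole (map std_tree ds)))"
    if "?cs = ds @ es" for ds es
    using that
  proof (induction ds arbitrary: es rule: rev_induct)
    case Nil
    then show ?case using u by (simp add: nrm_def)
  next
    case (snoc d ds)
    let ?p = "u @ concat ds"
    have IH: "ALSW ?p" "nrm s u [] (concat ds) (tev s (foldl Nd Hole (map std_tree ds)))"
      using snoc.IH[of "d # es"] snoc.prems by simp_all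
    have d: "d \<in> set ?cs" "ALSW d" using snoc.prems cs(2) by auto
    have "c = concat ds @ d @ concat es" using cs(1) snoc.prems by simp
    then have "lexgt (?p @ d @ concat es) d" using gt[OF d(1)] by simp
    then have A: "ALSW (?p @ d)" using ALSW_append[OF IH(1) d(2)] lexgt_shorten by blast
    have "deglexX (?p @ d) (d @ ?p)"
      using ALSW_deglexX_rotate[OF A] ALSW_not_Nil IH(1) d(2) by blast
    then have "nrm s u [] (concat ds @ d) (bracket (tev s (foldl Nd Hole (map std_tree ds))) (brk d))"
      using nrm_bracket(1)[OF IH(2) lead_brk[OF d(2)]] by simp
    then show ?case using A by (simp add: tev_std_tree d(2))
  qed
  from this[of ?cs "[]"] show ?thesis using cs(1) by simp
qed

text \<open>Descent along the standard tree: at each level the part containing the hole is bracketed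
  with a standard bracketing, and \<open>nrm_bracket\<close> applies because the word at the node is
  ALSW. \<open>off\<close> is where the current subtree starts, since \<open>repl\<close> counts
  positions in the whole word.\<close>

lemma nrm_repl:
  fixes s :: "('x::linorder, 'y, 'k::comm_ring_1) kpoly"
  assumes u: "ALSW u" and w: "ALSW (a @ u @ b)"
  defines "F \<equiv> \<lambda>wd. foldl Nd Hole (map std_tree (alsw_fact (drop (length u) wd)))"
  shows "nrm s u a b (tev s (repl (off + length a) (length u) F off (std_tree (a @ u @ b))))"
  using w
proof (induction "a @ u @ b" arbitrary: a b off rule: ALSW_std_induct)
  case (single x)
  then have e: "a = []" "u = [x]" "b = []"
    using ALSW_not_Nil[OF u] by (cases a; cases u; simp)+
  show ?case
    using nrm_special_top[of u "[]" s] u by (simp add: e std_tree_single F_def)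
next
  case (split w1 w2)
  have nn: "w1 \<noteq> []" "w2 \<noteq> []" "u \<noteq> []" using split.hyps(1,2) u ALSW_not_Nil by auto
  have rot: "deglexX (w1 @ w2) (w2 @ w1)"
    using ALSW_deglexX_rotate[OF split.hyps(3)] nn by simp
  have tw: "tword (std_tree w1) = w1" "tword (std_tree w2) = w2"
    using split.hyps(1,2) by (simp_all add: tword_std_tree)
  have w: "w1 @ w2 = a @ u @ b" by (rule split.hyps)
  have tree: "std_tree (a @ u @ b) = Nd (std_tree w1) (std_tree w2)"
    using split.hyps(5) w by simp
  have len: "length w1 + length w2 = length a + length u + length b"
    using arg_cong[OF w, of length] by simp
  consider "length a + length u \<le> length w1" | "length w1 \<le> length a"
    | "length a < length w1" "length w1 < length a + length u" by linarith
  then show ?case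
  proof cases
    case 1
    define b1 where "b1 = drop (length (a @ u)) w1"
    have w1: "w1 = a @ u @ b1"
    proof -
      have "take (length (a @ u)) (w1 @ w2) = a @ u" unfolding w by simp
      then have "take (length (a @ u)) w1 = a @ u" using 1 by simp
      then show ?thesis unfolding b1_def by (metis append_assoc append_take_drop_id)
    qed
    then have b: "b = b1 @ w2" using w by simp
    have "nrm s u a b1 (tev s (repl (off + length a) (length u) F off (std_tree w1)))"
      using split.hyps(6)[OF w1] w1 by simp
    from nrm_bracket(1)[OF this lead_brk[OF split.hyps(2)]]
    have "nrm s u a b (bracket (tev s (repl (off + length a) (length u) F off (std_tree w1))) (brk w2))"
      using rot w1 b by simp
    then show ?thesis
      using 1 unfolding tree by (simp add: tw tev_std_tree split.hyps(2) Let_def)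
  next
    case 2
    define a2 where "a2 = drop (length w1) a"
    have a: "a = w1 @ a2"
    proof -
      have "take (length w1) (a @ u @ b) = w1" unfolding w[symmetric] by simp
      then have "take (length w1) a = w1" using 2 by simp
      then show ?thesis unfolding a2_def by (metis append_take_drop_id)
    qed
    then have w2: "w2 = a2 @ u @ b" using w by simp
    have "nrm s u a2 b (tev s (repl ((off + length w1) + length a2) (length u) F (off + length w1) (std_tree w2)))"
      using split.hyps(7)[OF w2] w2 by simp
    from nrm_bracket(2)[OF this lead_brk[OF split.hyps(1)]]
    have "nrm s u a b (bracket (brk w1) (tev s (repl ((off + length w1) + length a2) (length u) F (off + length w1) (std_tree w2))))"
      using rot w2 a by simp
    moreover have "(off + length w1) + length a2 = off + length a" using a by simp
    moreover have "\<not> off + length a + length u \<le> off + length w1" using 2 nn by (cases u) auto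
    ultimately show ?thesis
      using 2 len unfolding tree by (simp add: tw tev_std_tree split.hyps(1) Let_def)
  next
    case 3
    define u1 where "u1 = drop (length a) w1"
    have w1: "w1 = a @ u1"
    proof -
      have "take (length a) (w1 @ w2) = a" unfolding w by simp
      then have "take (length a) w1 = a" using 3 by simp
      then show ?thesis unfolding u1_def by (metis append_take_drop_id)
    qed
    then have u1w: "u1 @ w2 = u @ b" using w by simp
    define u2 where "u2 = drop (length u1) u"
    have uu: "u = u1 @ u2"
    proof -
      have "take (length u1) (u @ b) = u1" unfolding u1w[symmetric] by simp
      then have "take (length u1) u = u1" using 3 w1 by simp
      then show ?thesis unfolding u2_def by (metis append_take_drop_id)
    qed
    then have w2: "w2 = u2 @ b" using u1w by simp
    have u2n: "u2 \<noteq> []" using 3 w1 uu by auto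
    \<comment> \<open>The cut falls inside \<open>u\<close>. With \<open>a\<close> nonempty,
      \<open>u @ b\<close> would be a proper suffix, ALSW by overlap and longer than
      \<open>w2\<close>. So this node is exactly \<open>[uc]\<close>, with
      \<open>c = b\<close>.\<close>
    have "a = []"
    proof (rule ccontr)
      assume an: "a \<noteq> []"
      have "ALSW (u1 @ u2 @ b)"
        using ALSW_overlap[of u1 u2 b] u uu w2 split.hyps(2) u2n by simp
      then have "std_cut (w1 @ w2) \<le> length a"
        using std_cut_le[of "w1 @ w2" a "u1 @ u2 @ b"] an w uu by simp
      then show False using 3 split.hyps(4) by simp
    qed
    then have "nrm s u a b (tev s (F (w1 @ w2)))"
      using nrm_special_top[OF u, of b s] split.hyps(3) w by (simp add: F_def)
    moreover have "repl (off + length a) (length u) F off (std_tree (a @ u @ b)) = F (w1 @ w2)"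
      using 3 unfolding tree by (simp add: tw Let_def)
    ultimately show ?thesis by simp
  qed
qed

lemma nrm_nsw:
  assumes "ALSW (LX s)" "ALSW (a @ LX s @ b)"
  shows "nrm s (LX s) a b (nsw a s b)"
  using nrm_repl[OF assms, of s 0] by (simp add: nsw_def special_tree_def)

section \<open>The composition-diamond lemma\<close>

lemma (in module) span_image_explicit:
  assumes "x \<in> span (f ` U)"
  obtains F c where "finite F" "F \<subseteq> U" "x = (\<Sum>w\<in>F. scale (c w) (f w))"
proof -
  from assms obtain t r where t: "finite t" "t \<subseteq> f ` U" "x = (\<Sum>a\<in>t. scale (r a) a)"
    unfolding span_explicit by blast
  from t(2) obtain F where F: "F \<subseteq> U" "inj_on f F" "t = f ` F"
    unfolding subset_image_inj by blast
  have "finite F" using t(1) F by (simp add: finite_image_iff)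
  moreover have "x = (\<Sum>w\<in>F. scale (r (f w)) (f w))"
    using t(3) F by (simp add: sum.reindex)
  ultimately show ?thesis by (intro that[of F "\<lambda>w. r (f w)"] F(1))
qed

definition is_ideal :: "'a::comm_ring_1 set \<Rightarrow> bool" where
  "is_ideal I \<longleftrightarrow> 0 \<in> I \<and> (\<forall>a\<in>I. \<forall>b\<in>I. a + b \<in> I) \<and> (\<forall>a\<in>I. \<forall>r. r * a \<in> I)"

lemma is_ideal_zero: "is_ideal I \<Longrightarrow> 0 \<in> I"
  and is_ideal_add: "is_ideal I \<Longrightarrow> a \<in> I \<Longrightarrow> b \<in> I \<Longrightarrow> a + b \<in> I"
  and is_ideal_mult: "is_ideal I \<Longrightarrow> a \<in> I \<Longrightarrow> r * a \<in> I"
  by (simp_all add: is_ideal_def)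

lemma is_ideal_mult_right: "is_ideal I \<Longrightarrow> a \<in> I \<Longrightarrow> a * r \<in> I"
  using is_ideal_mult[of I a r] by (simp add: mult.commute)

lemma is_ideal_diff: "is_ideal I \<Longrightarrow> a \<in> I \<Longrightarrow> b \<in> I \<Longrightarrow> a - b \<in> I"
  using is_ideal_add[of I a "(- 1) * b"] is_ideal_mult[of I b "- 1"] by simp

lemma is_ideal_sum: "is_ideal I \<Longrightarrow> (\<And>i. i \<in> F \<Longrightarrow> f i \<in> I) \<Longrightarrow> sum f F \<in> I"
  by (induction F rule: infinite_finite_induct) (simp_all add: is_ideal_zero is_ideal_add)

text \<open>Let \<open>w0\<close> be the largest index whose coefficient is outside
  \<open>I\<close>. Larger indices contribute only multiples of elements of \<open>I\<close>, and
  members of the family with smaller leading words do not reach \<open>w0\<close>; so modulo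
  \<open>I\<close> the sum has leading word \<open>w0\<close> with coefficient
  \<open>\<alpha> w0\<close>. No coefficient is inverted.\<close>

lemma triangular_top:
  fixes b :: "'x::linorder list \<Rightarrow> ('x, 'y, 'k::comm_ring_1) kpoly"
  assumes F: "finite F" and b: "\<And>w. w \<in> F \<Longrightarrow> lead (b w) w" and I: "is_ideal I"
    and w1: "w1 \<in> F" "\<alpha> w1 \<notin> I"
  defines "g \<equiv> \<Sum>w\<in>F. smul (\<alpha> w) (b w)"
  obtains w0 where "w0 \<in> F" "\<And>v. v \<in> F \<Longrightarrow> \<alpha> v \<notin> I \<Longrightarrow> v \<noteq> w0 \<Longrightarrow> deglexX w0 v"
    "cf g w0 - \<alpha> w0 \<in> I" "cf g w0 \<notin> I" "\<And>v. deglexX v w0 \<Longrightarrow> cf g v \<in> I"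
proof -
  let ?H = "{w\<in>F. \<alpha> w \<notin> I}"
  have "finite ?H" "?H \<noteq> {}" using F w1 by auto
  from finite_deglexX_max[OF this] obtain w0
    where w0: "w0 \<in> ?H" and max: "\<forall>v\<in>?H. v \<noteq> w0 \<longrightarrow> deglexX w0 v" by blast
  have w0F: "w0 \<in> F" "\<alpha> w0 \<notin> I" using w0 by auto
  have cg: "cf g v = (\<Sum>w\<in>F. \<alpha> w * cf (b w) v)" for v
    by (simp add: g_def cf_sum cf_smul)
  have small: "\<alpha> w * cf (b w) v \<in> I"
    if w: "w \<in> F" and v: "w \<noteq> w0 \<or> v \<noteq> w0" "v = w0 \<or> deglexX v w0" for w v
  proof (cases "\<alpha> w \<in> I")
    case True
    then show ?thesis using I is_ideal_mult_right by blast
  next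
    case False
    then have "w = w0 \<or> deglexX w0 w" using max w by blast
    then have vw: "deglexX v w" using v deglexX_trans[of v w0 w] by auto
    then have "v \<noteq> w" "\<not> deglexX w v" using deglexX_asym by auto
    then have "cf (b w) v = 0" using b[OF w] unfolding lead_iff_cf by metis
    then show ?thesis using I is_ideal_zero by simp
  qed
  have "cf g w0 = \<alpha> w0 * cf (b w0) w0 + (\<Sum>w\<in>F - {w0}. \<alpha> w * cf (b w) w0)"
    unfolding cg using F w0F by (simp add: sum.remove)
  moreover have "cf (b w0) w0 = 1" using b[OF w0F(1)] by (simp add: lead_iff_cf)
  moreover have "(\<Sum>w\<in>F - {w0}. \<alpha> w * cf (b w) w0) \<in> I"
    using I by (rule is_ideal_sum) (use small in auto)
  ultimately have d: "cf g w0 - \<alpha> w0 \<in> I" by simp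
  have n: "cf g w0 \<notin> I"
  proof
    assume "cf g w0 \<in> I"
    from is_ideal_diff[OF I this d] w0F(2) show False by simp
  qed
  have up: "cf g v \<in> I" if "deglexX v w0" for v
  proof -
    have "v \<noteq> w0" using that by auto
    then show ?thesis
      unfolding cg using I by (intro is_ideal_sum) (use small that in blast)+
  qed
  show ?thesis
    by (rule that[OF w0F(1) _ d n up]) (use max in auto)
qed

lemma insert_below_subset: "deglexX w v \<Longrightarrow> insert v (below v) \<subseteq> below w"
  by (auto intro: deglexX_trans[of w v])

lemma isY_eq_embedY: "isY c \<Longrightarrow> c = embedY (cf c [])"
proof (rule kpoly_eqI)
  fix w assume c: "isY c"
  have e: "embedY (cf c []) = smul (cf c []) (mon [])" by (simp add: smul_def)
  have "cf c w = 0" if "w \<noteq> []"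
    using c that by (intro poly_mapping_eqI) (force simp: isY_def lookup_cf in_keys_iff)
  then show "cf c w = cf (embedY (cf c [])) w"
    by (auto simp: e cf_smul cf_mon)
qed

lemma pmul_isY: "isY c \<Longrightarrow> pmul c p = smul (cf c []) p"
  using arg_cong[OF isY_eq_embedY, of c "\<lambda>z. pmul z p"] by (simp only: smul_def)

text \<open>The coefficient \<open>1\<close> of \<open>k[Y]\<close> consists of the single monomial
  \<open>1\<close>, so the maximal pair has trivial \<open>Y\<close>-part.\<close>

lemma lm_lead:
  fixes f :: "('x::linorder, 'y::linorder, 'k::comm_ring_1) kpoly"
  assumes "lead f w"
  shows "lm f = (0, w)"
  unfolding lm_def
proof (rule the_equality)
  have l: "cf f w = 1" "\<And>v. v \<noteq> w \<Longrightarrow> cf f v \<noteq> 0 \<Longrightarrow> deglexX w v"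
    using assms by (auto simp: lead_iff_cf)
  have k: "m = (0, w) \<or> deglexX w (snd m)" if "m \<in> Poly_Mapping.keys f" for m
  proof -
    have nz: "Poly_Mapping.lookup (cf f (snd m)) (fst m) \<noteq> 0"
      using that by (simp add: lookup_cf in_keys_iff)
    show ?thesis
    proof (cases "snd m = w")
      case True
      then have "fst m = 0" using nz l(1) by (simp add: lookup_one when_def split: if_splits)
      then show ?thesis using True by (metis prod.collapse)
    next
      case False
      moreover have "cf f (snd m) \<noteq> 0" using nz by auto
      ultimately show ?thesis using l(2) by blast
    qed
  qed
  have "Poly_Mapping.lookup f (0, w) = 1"
    using l(1) by (metis lookup_cf lookup_one_zero)
  then have in0: "(0, w) \<in> Poly_Mapping.keys f" by (simp add: in_keys_iff)
  show "(0, w) \<in> Poly_Mapping.keys f \<and> (\<forall>m'\<in>Poly_Mapping.keys f. m' \<noteq> (0, w) \<longrightarrow> mgt (0, w) m')"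
    using in0 k by (auto simp: mgt_def)
  fix m assume m: "m \<in> Poly_Mapping.keys f \<and> (\<forall>m'\<in>Poly_Mapping.keys f. m' \<noteq> m \<longrightarrow> mgt m m')"
  show "m = (0, w)"
  proof (rule ccontr)
    assume ne: "m \<noteq> (0, w)"
    then have "deglexX w (snd m)" using k m by blast
    moreover have "mgt m (0, w)" using m in0 ne by metis
    then have "deglexX (snd m) w \<or> snd m = w" by (auto simp: mgt_def)
    ultimately show False using deglexX_asym deglexX_irrefl by metis
  qed
qed

text \<open>The top bracketing has coefficient \<open>1\<close> and all others have smaller words,
  whatever their coefficients; since words are compared before \<open>Y\<close>-monomials, the top
  word leads.\<close>

lemma kY_monic_lead:
  fixes f :: "('x::linorder, 'y::linorder, 'k::comm_ring_1) kpoly"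
  assumes "kY_monic f"
  shows "LY f = 0" "ALSW (LX f)" "lead f (LX f)"
proof -
  from assms obtain U c u1 where U: "finite U" "U \<subseteq> {u. ALSW u}" "\<forall>u\<in>U. isY (c u)"
    and f: "f = (\<Sum>u\<in>U. pmul (c u) (brk u))"
    and u1: "u1 \<in> U" "\<forall>v\<in>U. v \<noteq> u1 \<longrightarrow> deglexX u1 v" "c u1 = Poly_Mapping.single (0, []) 1"
    unfolding kY_monic_def by blast
  have A1: "ALSW u1" using U u1 by auto
  have "pmul (c u1) (brk u1) = (brk u1 :: ('x, 'y, 'k) kpoly)" using u1(3) by (simp add: mon_def[symmetric])
  then have "f - mon u1 = (brk u1 - mon u1) + (\<Sum>u\<in>U - {u1}. pmul (c u) (brk u))"
    using f U(1) u1(1) by (simp add: sum.remove)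
  moreover have "(brk u1 - mon u1 :: ('x, 'y, 'k) kpoly) \<in> wspan one_gen (below u1)"
    using lead_brk[OF A1] by (simp add: lead_def)
  moreover have "(\<Sum>u\<in>U - {u1}. pmul (c u) (brk u)) \<in> wspan one_gen (below u1)"
    unfolding wspan_def
  proof (rule A.span_sum, unfold wspan_def[symmetric])
    fix u assume u: "u \<in> U - {u1}"
    then have "(brk u :: ('x, 'y, 'k) kpoly) \<in> wspan one_gen (insert u (below u))"
      using lead_wspan lead_brk U by blast
    moreover have "insert u (below u) \<subseteq> below u1"
      using u u1(2) by (intro insert_below_subset) simp
    ultimately have "(brk u :: ('x, 'y, 'k) kpoly) \<in> wspan one_gen (below u1)"
      using wspan_mono[of one_gen one_gen "insert u (below u)" "below u1"] by blast
    then show "pmul (c u) (brk u) \<in> wspan one_gen (below u1)"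
      using U(3) u by (simp add: pmul_isY wspan_smul)
  qed
  ultimately have l: "lead f u1" unfolding lead_def by (simp only: wspan_add)
  then have "lm f = (0, u1)" by (rule lm_lead)
  with l A1 show "LY f = 0" "ALSW (LX f)" "lead f (LX f)" by simp_all
qed

definition gens :: "('x::linorder, 'y::linorder, 'k::comm_ring_1) kpoly set \<Rightarrow> (('x, 'y, 'k) kpoly \<times> 'x list) set" where
  "gens S = (\<lambda>s. (s, LX s)) ` S"

text \<open>Since \<open>1\<close> is the least monomial in \<open>Y\<close>, lying below
  \<open>(0, w)\<close> forces the word itself to drop.\<close>

lemma not_deglexY_zero: "\<not> deglexY 0 b"
proof -
  have "b = 0" if "ydeg b = 0"
    using that by (intro poly_mapping_eqI) (auto simp: ydeg_def in_keys_iff)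
  then show ?thesis by (auto simp: deglexY_def ydeg_def[of 0])
qed

section \<open>From Lie compositions to associative compositions\<close>

locale monic_GSB =
  fixes S :: "('x::wellorder, 'y::wellorder, 'k::field) kpoly set"
  assumes GSB: "GSB S" and monic: "\<And>s. s \<in> S \<Longrightarrow> kY_monic s"
begin

lemma S_lead: "s \<in> S \<Longrightarrow> lead s (LX s)" and S_ALSW: "s \<in> S \<Longrightarrow> ALSW (LX s)"
  and S_LY: "s \<in> S \<Longrightarrow> LY s = 0"
  using kY_monic_lead monic by blast+

lemma nsw_in_wspan:
  assumes "s \<in> S" "ALSW (a @ LX s @ b)"
  shows "nsw a s b - sword a s b \<in> wspan (gens S) (below (a @ LX s @ b))"
    and "nsw a s b \<in> wspan (gens S) (insert (a @ LX s @ b) (below (a @ LX s @ b)))"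
proof -
  have n: "nrm s (LX s) a b (nsw a s b)" using nrm_nsw S_ALSW assms by blast
  have G: "{(s, LX s)} \<subseteq> gens S" using assms(1) by (auto simp: gens_def)
  show "nsw a s b - sword a s b \<in> wspan (gens S) (below (a @ LX s @ b))"
    using n wspan_mono[OF G order_refl] unfolding nrm_def by blast
  show "nsw a s b \<in> wspan (gens S) (insert (a @ LX s @ b) (below (a @ LX s @ b)))"
    using nrm_wspan[OF n] wspan_mono[OF G order_refl] by blast
qed

text \<open>Lie triviality implies associative triviality: a normal s-word below \<open>w\<close>
  expands into associative s-words that stay below \<open>w\<close>.\<close>

lemma trivial_mod_wspan:
  assumes "trivial_mod S (0, w) h"
  shows "h \<in> wspan (gens S) (below w)"
proof -
  from assms obtain ts where
    h: "h = sum_list (map (\<lambda>(\<alpha>, \<beta>, a, s, b). pmul (Poly_Mapping.single (\<beta>, []) \<alpha>) (nsw a s b)) ts)"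
    and ts: "\<forall>(\<alpha>, \<beta>, a, s, b)\<in>set ts. s \<in> S \<and> ALSW (a @ LX s @ b)
          \<and> mgt (0, w) (\<beta> + LY s, a @ LX s @ b)"
    unfolding trivial_mod_def by blast
  have one: "pmul (Poly_Mapping.single (\<beta>, []) \<alpha>) (nsw a s b) \<in> wspan (gens S) (below w)"
    if "(\<alpha>, \<beta>, a, s, b) \<in> set ts" for \<alpha> \<beta> a s b
  proof -
    have s: "s \<in> S" "ALSW (a @ LX s @ b)" and m: "mgt (0, w) (\<beta> + LY s, a @ LX s @ b)"
      using ts that by auto
    have "deglexX w (a @ LX s @ b)" using m not_deglexY_zero by (auto simp: mgt_def)
    then have "insert (a @ LX s @ b) (below (a @ LX s @ b)) \<subseteq> below w"
      by (rule insert_below_subset)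
    then have "nsw a s b \<in> wspan (gens S) (below w)"
      using nsw_in_wspan(2)[OF s] wspan_mono by blast
    then have "smul (Poly_Mapping.single \<beta> \<alpha>) (nsw a s b) \<in> wspan (gens S) (below w)"
      by (rule wspan_smul)
    then show ?thesis by (simp add: smul_def embedY_single)
  qed
  have "sum_list (map (\<lambda>(\<alpha>, \<beta>, a, s, b). pmul (Poly_Mapping.single (\<beta>, []) \<alpha>) (nsw a s b)) us)
      \<in> wspan (gens S) (below w)" if "set us \<subseteq> set ts" for us
    using that
  proof (induction us)
    case (Cons t us)
    then have "(\<lambda>(\<alpha>, \<beta>, a, s, b). pmul (Poly_Mapping.single (\<beta>, []) \<alpha>) (nsw a s b)) t
        \<in> wspan (gens S) (below w)"
      using one by (auto split: prod.splits)
    with Cons show ?case by (simp add: wspan_add)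
  qed simp
  then show ?thesis using h by blast
qed

lemma yscale_zero: "yscale 0 p = (p :: ('x, 'y, 'k) kpoly)"
  by (simp add: yscale_def cY_def mon_def[symmetric])

lemma composition_inclusion:
  assumes "f \<in> S" "g \<in> S" "LX f = a @ LX g @ b"
  shows "f - sword a g b \<in> wspan (gens S) (below (LX f))"
proof -
  have "lcmY (LY f) (LY g) = 0" using S_LY assms by (simp add: lcmY_def)
  then have "trivial_mod S (0, LX f) (yscale (0 - LY f) f - yscale (0 - LY g) (nsw a g b))"
    using GSB assms unfolding GSB_def Let_def by metis
  then have "f - nsw a g b \<in> wspan (gens S) (below (LX f))"
    using trivial_mod_wspan S_LY assms by (simp add: yscale_zero)
  moreover have "nsw a g b - sword a g b \<in> wspan (gens S) (below (LX f))"
    using nsw_in_wspan(1)[of g a b] S_ALSW[of f] assms by simp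
  ultimately show ?thesis using wspan_add by fastforce
qed

lemma composition_overlap:
  assumes "f \<in> S" "g \<in> S" "LX f = a @ c" "LX g = c @ b" "a \<noteq> []" "b \<noteq> []" "c \<noteq> []"
  shows "sword [] f b - sword a g [] \<in> wspan (gens S) (below (a @ c @ b))"
proof -
  have "lcmY (LY f) (LY g) = 0" using S_LY assms by (simp add: lcmY_def)
  then have "trivial_mod S (0, LX f @ b) (yscale (0 - LY f) (nsw [] f b) - yscale (0 - LY g) (nsw a g []))"
    using GSB assms unfolding GSB_def Let_def by metis
  then have n: "nsw [] f b - nsw a g [] \<in> wspan (gens S) (below (a @ c @ b))"
    using trivial_mod_wspan S_LY assms by (simp add: yscale_zero)
  \<comment> \<open>Comparing normal with associative s-words requires the whole word to be ALSW;
    overlapping ALSWs provide this.\<close>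
  have A: "ALSW (a @ c @ b)"
    using ALSW_overlap[of a c b] S_ALSW[of f] S_ALSW[of g] assms by simp
  have f: "nsw [] f b - sword [] f b \<in> wspan (gens S) (below (a @ c @ b))"
    using nsw_in_wspan(1)[of f "[]" b] A assms by simp
  have g: "nsw a g [] - sword a g [] \<in> wspan (gens S) (below (a @ c @ b))"
    using nsw_in_wspan(1)[of g a "[]"] A assms by simp
  from wspan_add[OF wspan_diff[OF n f] g] show ?thesis by simp
qed

text \<open>Write \<open>f'\<close>, \<open>g'\<close> for the leading words. Then
  \<open>f c g' - f' c g = (f - f') c g - f c (g - g')\<close>, and on the right one factor has lost
  its leading word in each product.\<close>

lemma composition_disjoint:
  assumes "f \<in> S" "g \<in> S"
  shows "sword [] f (c @ LX g) - sword (LX f @ c) g [] \<in> wspan (gens S) (below (LX f @ c @ LX g))"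
proof -
  have f0: "f - mon (LX f) \<in> wspan one_gen (below (LX f))"
    and g0: "g - mon (LX g) \<in> wspan one_gen (below (LX g))"
    using S_lead assms by (auto simp: lead_def)
  have "(f, LX f) \<in> gens S" "(g, LX g) \<in> gens S" using assms by (auto simp: gens_def)
  then have "sword [] f c \<in> wspan (gens S) {LX f @ c}" "sword c g [] \<in> wspan (gens S) {c @ LX g}"
    using sword_in_wspan[of f "LX f" "gens S" "[]" c] sword_in_wspan[of g "LX g" "gens S" c "[]"]
    by simp_all
  note s = this
  have "pmul (f - mon (LX f)) (sword c g []) \<in> wspan (gens S) (below (LX f @ c @ LX g))"
    by (rule pmul_wspan_left[OF f0 s(2)]) auto
  moreover have "pmul (sword [] f c) (g - mon (LX g)) \<in> wspan (gens S) (below (LX f @ c @ LX g))"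
    by (rule pmul_wspan_right[OF s(1) g0]) auto
  moreover have "sword [] f (c @ LX g) - sword (LX f @ c) g []
    = pmul (f - mon (LX f)) (sword c g []) - pmul (sword [] f c) (g - mon (LX g))"
    by (simp add: pmul_diff_left pmul_diff_right pmul_sword_mon pmul_mon_sword)
      (simp add: sword_def pmul_assoc)
  ultimately show ?thesis using wspan_diff by metis
qed

text \<open>Two occurrences are disjoint, nested or overlapping. The hypothesis \<open>le\<close>
  lets \<open>LX f\<close> start first and gives ties to the longer word, so that in the nested case
  \<open>LX g\<close> lies inside \<open>LX f\<close>.\<close>

lemma sword_ambiguity_le:
  assumes f: "f \<in> S" and g: "g \<in> S" and eq: "a @ LX f @ b = a' @ LX g @ b'"
    and le: "length a < length a' \<or> length a = length a' \<and> length (LX g) \<le> length (LX f)"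
  shows "sword a f b - sword a' g b' \<in> wspan (gens S) (below (a @ LX f @ b))"
proof -
  define p where "p = drop (length a) a'"
  have "take (length a) (a' @ LX g @ b') = a" unfolding eq[symmetric] by simp
  then have "take (length a) a' = a" using le by auto
  then have a': "a' = a @ p" unfolding p_def by (metis append_take_drop_id)
  then have eq1: "LX f @ b = p @ LX g @ b'" using eq by simp
  have len: "length (LX f) + length b = length p + length (LX g) + length b'"
    using arg_cong[OF eq1, of length] by simp
  \<comment> \<open>Strips the common context: smallness of a composition is preserved under
    multiplication by \<open>a\<close> and \<open>b''\<close>.\<close>
  have core: "\<exists>c d x y w. sword a f b - sword a' g b' = sword a (sword c f d - sword x g y) b'' \<and>
      sword c f d - sword x g y \<in> wspan (gens S) (below w) \<and> a @ w @ b'' = a @ LX f @ b \<Longrightarrow> ?thesis" for b''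
    using sword_wspan by metis
  consider "length (LX f) \<le> length p" | "length p + length (LX g) \<le> length (LX f)"
    | "length p < length (LX f)" "length (LX f) < length p + length (LX g)" by linarith
  then show ?thesis
  proof cases
    case 1
    define c where "c = drop (length (LX f)) p"
    have "take (length (LX f)) (p @ LX g @ b') = LX f" unfolding eq1[symmetric] by simp
    then have p: "p = LX f @ c" unfolding c_def using 1
      by (metis append_take_drop_id take_append diff_is_0_eq take_0 append_Nil2)
    then have b: "b = c @ LX g @ b'" using eq1 by simp
    show ?thesis
    proof (rule core[of b'], intro exI conjI)
      show "sword a f b - sword a' g b' = sword a (sword [] f (c @ LX g) - sword (LX f @ c) g []) b'"
        by (simp add: sword_diff sword_sword a' p b)
      show "sword [] f (c @ LX g) - sword (LX f @ c) g [] \<in> wspan (gens S) (below (LX f @ c @ LX g))"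
        by (rule composition_disjoint[OF f g])
    qed (simp add: b)
  next
    case 2
    define q where "q = drop (length (p @ LX g)) (LX f)"
    have "take (length (p @ LX g)) (LX f @ b) = p @ LX g" unfolding eq1 by simp
    then have "take (length (p @ LX g)) (LX f) = p @ LX g" using 2 by simp
    then have F: "LX f = p @ LX g @ q" unfolding q_def by (metis append_assoc append_take_drop_id)
    then have b': "b' = q @ b" using eq1 by simp
    show ?thesis
    proof (rule core[of b], intro exI conjI)
      show "sword a f b - sword a' g b' = sword a (sword [] f [] - sword p g q) b"
        by (simp only: sword_diff sword_sword a' b' append_Nil append_Nil2)
      show "sword [] f [] - sword p g q \<in> wspan (gens S) (below (LX f))"
        using composition_inclusion[OF f g F] by simp
    qed simp
  next
    case 3
    define y where "y = drop (length p) (LX f)"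
    have "take (length p) (LX f @ b) = p" unfolding eq1 by simp
    then have "take (length p) (LX f) = p" using 3 by simp
    then have F: "LX f = p @ y" unfolding y_def by (metis append_take_drop_id)
    then have eq2: "y @ b = LX g @ b'" using eq1 by simp
    define q where "q = drop (length y) (LX g)"
    have "take (length y) (LX g @ b') = y" unfolding eq2[symmetric] by simp
    then have "take (length y) (LX g) = y" using 3 F by simp
    then have G: "LX g = y @ q" unfolding q_def by (metis append_take_drop_id)
    then have b: "b = q @ b'" using eq2 by simp
    have nn: "y \<noteq> []" "q \<noteq> []" using 3 F G by auto
    \<comment> \<open>If \<open>p\<close> were empty, both words would start at the same place,
      where \<open>le\<close> makes \<open>LX g\<close> no longer than \<open>LX f\<close>, against
      the case assumption.\<close>
    have "p \<noteq> []" using le 3 F G nn a' by auto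
    show ?thesis
    proof (rule core[of b'], intro exI conjI)
      show "sword a f b - sword a' g b' = sword a (sword [] f q - sword p g []) b'"
        by (simp add: sword_diff sword_sword a' b)
      show "sword [] f q - sword p g [] \<in> wspan (gens S) (below (p @ y @ q))"
        using composition_overlap[OF f g F G] nn \<open>p \<noteq> []\<close> by simp
    qed (simp add: b F)
  qed
qed

lemma sword_ambiguity:
  assumes f: "f \<in> S" and g: "g \<in> S" and eq: "a @ LX f @ b = a' @ LX g @ b'"
  shows "sword a f b - sword a' g b' \<in> wspan (gens S) (below (a @ LX f @ b))"
proof -
  consider "length a < length a' \<or> length a = length a' \<and> length (LX g) \<le> length (LX f)"
    | "length a' < length a \<or> length a' = length a \<and> length (LX f) \<le> length (LX g)" by linarith
  then show ?thesis
  proof cases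
    case 1
    then show ?thesis using sword_ambiguity_le[OF assms] by simp
  next
    case 2
    from sword_ambiguity_le[OF g f eq[symmetric] this]
    have "sword a' g b' - sword a f b \<in> wspan (gens S) (below (a @ LX f @ b))" unfolding eq .
    from wspan_diff[OF wspan_zero this] show ?thesis by simp
  qed
qed

section \<open>Reducible words and independence of the irreducible ones\<close>

definition Red :: "'x list set" where
  "Red = {a @ LX s @ b | a s b. s \<in> S}"

text \<open>Which s-word is chosen is immaterial, since by \<open>sword_ambiguity\<close> two with
  the same word differ by lower ones. Keeping one per word makes the family unitriangular.\<close>

definition rep :: "'x list \<Rightarrow> ('x, 'y, 'k) kpoly" where
  "rep w = (SOME p. \<exists>a s b. s \<in> S \<and> w = a @ LX s @ b \<and> p = sword a s b)"

lemma rep: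
  assumes "w \<in> Red"
  obtains a s b where "s \<in> S" "w = a @ LX s @ b" "rep w = sword a s b"
proof -
  have "\<exists>p. \<exists>a s b. s \<in> S \<and> w = a @ LX s @ b \<and> p = sword a s b" using assms by (auto simp: Red_def)
  from someI_ex[OF this] show ?thesis using that unfolding rep_def by blast
qed

lemma lead_sword: "s \<in> S \<Longrightarrow> lead (sword a s b) (a @ LX s @ b)"
  using sword_wspan[of "s - mon (LX s)" one_gen "LX s" a b] S_lead[of s]
  by (simp add: lead_def sword_diff sword_mon)

lemma lead_rep: "w \<in> Red \<Longrightarrow> lead (rep w) w"
  by (erule rep) (simp add: lead_sword)

lemma wspan_gens_subset:
  assumes "\<And>w. w \<in> W \<Longrightarrow> insert w (below w) \<subseteq> V"
  shows "wspan (gens S) W \<subseteq> wspan one_gen V"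
  unfolding wspan_def[of "gens S"]
proof (rule A.span_minimal)
  show "{sword a s b | a s u b. (s, u) \<in> gens S \<and> a @ u @ b \<in> W} \<subseteq> wspan one_gen V"
  proof
    fix p assume "p \<in> {sword a s b | a s u b. (s, u) \<in> gens S \<and> a @ u @ b \<in> W}"
    then obtain a s b where p: "s \<in> S" "p = sword a s b" "a @ LX s @ b \<in> W" by (auto simp: gens_def)
    show "p \<in> wspan one_gen V"
      using lead_wspan[OF lead_sword[OF p(1), of a b]] wspan_mono[OF order_refl assms[OF p(3)]] p(2)
      by blast
  qed
  show "A.subspace (wspan one_gen V)"
    unfolding wspan_def by (rule A.subspace_span)
qed

lemma lead_nsw:
  assumes "s \<in> S" "ALSW (a @ LX s @ b)"
  shows "lead (nsw a s b) (a @ LX s @ b)"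
proof -
  let ?w = "a @ LX s @ b"
  have "wspan (gens S) (below ?w) \<subseteq> wspan one_gen (below ?w)"
    by (rule wspan_gens_subset) (rule insert_below_subset, simp)
  then have "nsw a s b - sword a s b \<in> wspan one_gen (below ?w)"
    using nsw_in_wspan(1)[OF assms] by blast
  moreover have "sword a s b - mon ?w \<in> wspan one_gen (below ?w)"
    using lead_sword[OF assms(1)] by (simp add: lead_def)
  ultimately have "(nsw a s b - sword a s b) + (sword a s b - mon ?w) \<in> wspan one_gen (below ?w)"
    by (rule wspan_add)
  then show ?thesis by (simp add: lead_def)
qed

text \<open>Well-founded induction on the word: replacing an s-word by the representative of its
  word costs only s-words with smaller words.\<close>

lemma sword_in_span_rep:
  "s \<in> S \<Longrightarrow> sword a s b \<in> A.span (rep ` Red)"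
proof (induction "a @ LX s @ b" arbitrary: a s b rule: wf_induct_rule[OF wf_deglexX])
  case 1
  let ?w = "a @ LX s @ b"
  have w: "?w \<in> Red" using 1(2) by (auto simp: Red_def)
  then obtain a' s' b' where r: "s' \<in> S" "?w = a' @ LX s' @ b'" "rep ?w = sword a' s' b'" by (rule rep)
  have "{sword c t d | c t u d. (t, u) \<in> gens S \<and> c @ u @ d \<in> below ?w} \<subseteq> A.span (rep ` Red)"
    using 1(1) by (auto simp: gens_def)
  then have "wspan (gens S) (below ?w) \<subseteq> A.span (rep ` Red)"
    unfolding wspan_def by (rule A.span_minimal) (rule A.subspace_span)
  then have "sword a s b - rep ?w \<in> A.span (rep ` Red)"
    using sword_ambiguity[OF 1(2) r(1,2)] r(3) by auto
  moreover have "rep ?w \<in> A.span (rep ` Red)" using w by (intro A.span_base) auto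
  ultimately show ?case using A.span_add by fastforce
qed

text \<open>Modulo polynomials with all coefficients in \<open>I\<close>, only the s-words remain.
  Such polynomials absorb multiplication from both sides, as their expansion into words shows, and
  they contain the image of \<open>R\<close>.\<close>

lemma aideal_subset:
  fixes R :: "(('y \<Rightarrow>\<^sub>0 nat) \<Rightarrow>\<^sub>0 'k) set"
  assumes I: "is_ideal I" and R: "R \<subseteq> I" and f: "f \<in> aideal (URels R S)"
  shows "\<exists>g r. f = g + r \<and> g \<in> A.span (rep ` Red) \<and> (\<forall>w. cf r w \<in> I)"
proof -
  have "\<exists>g r. f = g + r \<and> g \<in> wspan (gens S) UNIV \<and> (\<forall>w. cf r w \<in> I)"
    using f
  proof (induction rule: aideal.induct)
    case (gen g)
    then consider "g \<in> S" | t where "t \<in> R" "g = embedY t" by (auto simp: URels_def)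
    then show ?case
    proof cases
      case 1
      then have "sword [] g [] \<in> wspan (gens S) UNIV"
        by (intro sword_in_wspan[of _ "LX g"]) (auto simp: gens_def)
      then show ?thesis using is_ideal_zero[OF I] by (intro exI[of _ g] exI[of _ 0]) simp
    next
      case 2
      have "g = smul t (mon [])" using 2 by (simp add: smul_def)
      then have "cf g w \<in> I" for w
        using 2 R is_ideal_mult_right[OF I, of t] by (auto simp: cf_smul)
      then show ?thesis by (intro exI[of _ 0] exI[of _ g]) simp
    qed
  next
    case zero
    then show ?case using is_ideal_zero[OF I] by (intro exI[of _ 0]) simp
  next
    case (add p q)
    then obtain g r g' r' where "p = g + r" "q = g' + r'" and g: "g \<in> wspan (gens S) UNIV" "g' \<in> wspan (gens S) UNIV"
      and "\<forall>w. cf r w \<in> I" "\<forall>w. cf r' w \<in> I" by blast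
    then show ?case using wspan_add[OF g] is_ideal_add[OF I]
      by (intro exI[of _ "g + g'"] exI[of _ "r + r'"]) (simp add: cf_add)
  next
    case (mulr p q)
    then obtain g r where p: "p = g + r" "g \<in> wspan (gens S) UNIV" "\<forall>w. cf r w \<in> I" by blast
    have "pmul g q \<in> wspan (gens S) UNIV"
      by (rule pmul_wspan_right[OF p(2), of q UNIV]) (auto simp: wspan_one_gen)
    moreover have "cf (pmul r q) w \<in> I" for w
    proof -
      have "pmul r q = (\<Sum>w\<in>{w. cf r w \<noteq> 0}. smul (cf r w) (pmul (mon w) q))"
      proof -
        interpret L: additive "\<lambda>r. pmul r q" by unfold_locales (rule pmul_add_left)
        show ?thesis
          by (subst kpoly_expand[OF finite_cf order_refl, of r]) (simp add: L.sum smul_pmul_left)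
      qed
      then show ?thesis using p(3) is_ideal_mult_right[OF I]
        by (auto simp: cf_sum cf_smul intro!: is_ideal_sum[OF I])
    qed
    ultimately show ?case using p(1)
      by (intro exI[of _ "pmul g q"] exI[of _ "pmul r q"]) (simp add: pmul_add_left)
  next
    case (mull p q)
    then obtain g r where p: "p = g + r" "g \<in> wspan (gens S) UNIV" "\<forall>w. cf r w \<in> I" by blast
    have "pmul q g \<in> wspan (gens S) UNIV"
      by (rule pmul_wspan_left[OF _ p(2), of q UNIV]) (auto simp: wspan_one_gen)
    moreover have "cf (pmul q r) w \<in> I" for w
    proof -
      have "pmul q r = (\<Sum>w\<in>{w. cf r w \<noteq> 0}. smul (cf r w) (pmul q (mon w)))"
      proof -
        interpret L: additive "\<lambda>r. pmul q r" by unfold_locales (rule pmul_add_right)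
        show ?thesis
          by (subst kpoly_expand[OF finite_cf order_refl, of r]) (simp add: L.sum smul_pmul_right)
      qed
      then show ?thesis using p(3) is_ideal_mult_right[OF I]
        by (auto simp: cf_sum cf_smul intro!: is_ideal_sum[OF I])
    qed
    ultimately show ?case using p(1)
      by (intro exI[of _ "pmul q g"] exI[of _ "pmul q r"]) (simp add: pmul_add_right)
  qed
  moreover have "wspan (gens S) UNIV \<subseteq> A.span (rep ` Red)"
    unfolding wspan_def
    by (rule A.span_minimal) (auto simp: gens_def sword_in_span_rep)
  ultimately show ?thesis by blast
qed

lemma irreducible_independent:
  assumes I: "is_ideal I" and R: "R \<subseteq> I" and F: "finite F" "\<And>u. u \<in> F \<Longrightarrow> ALSW u" "F \<inter> Red = {}"
    and f: "(\<Sum>u\<in>F. smul (c u) (brk u)) \<in> aideal (URels R S)" (is "?f \<in> _")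
    and u: "u \<in> F"
  shows "c u \<in> I"
proof (rule ccontr)
  assume nI: "c u \<notin> I"
  obtain w0 where w0: "w0 \<in> F" "cf ?f w0 \<notin> I" "\<And>v. deglexX v w0 \<Longrightarrow> cf ?f v \<in> I"
    by (rule triangular_top[where \<alpha> = c, OF F(1) lead_brk[OF F(2)] I u nI]) blast+
  from aideal_subset[OF I R f] obtain g r where fg: "?f = g + r" and g: "g \<in> A.span (rep ` Red)"
    and r: "\<forall>w. cf r w \<in> I" by blast
  \<comment> \<open>As \<open>r\<close> vanishes modulo \<open>I\<close>, the polynomials
    \<open>?f\<close> and \<open>g\<close> have the same words with coefficient outside
    \<open>I\<close>. The largest such word is \<open>w0\<close> seen from \<open>?f\<close> and
    \<open>w2\<close> seen from \<open>g\<close>, yet only \<open>w2\<close> is reducible.\<close>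
  have cfg: "cf ?f w \<in> I \<longleftrightarrow> cf g w \<in> I" for w
    using is_ideal_add[OF I, of "cf g w" "cf r w"] is_ideal_diff[OF I, of "cf g w + cf r w" "cf r w"] r
    unfolding fg by (auto simp: cf_add)
  from g obtain H d where H: "finite H" "H \<subseteq> Red" "g = (\<Sum>w\<in>H. smul (d w) (rep w))"
    by (rule A.span_image_explicit)
  have "\<exists>w\<in>H. d w \<notin> I"
  proof (rule ccontr)
    assume "\<not> ?thesis"
    then have "cf g w0 \<in> I" unfolding H(3) using is_ideal_mult_right[OF I]
      by (auto simp: cf_sum cf_smul intro!: is_ideal_sum[OF I])
    then show False using w0(2) cfg by blast
  qed
  then obtain w1 where w1: "w1 \<in> H" "d w1 \<notin> I" by blast
  have lr: "\<And>w. w \<in> H \<Longrightarrow> lead (rep w) w" using H(2) lead_rep by blast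
  obtain w2 where w2: "w2 \<in> H" "cf g w2 \<notin> I" "\<And>v. deglexX v w2 \<Longrightarrow> cf g v \<in> I"
    by (rule triangular_top[where \<alpha> = d, OF H(1) lr I w1]) (unfold H(3)[symmetric], blast+)
  have "w0 \<noteq> w2" using w0(1) w2(1) H(2) F(3) by blast
  then consider "deglexX w0 w2" | "deglexX w2 w0" using deglexX_total by blast
  then show False
    using w0(2,3) w2(2,3) cfg by cases blast+
qed

end

section \<open>Spanning sets of the Lie algebra\<close>

fun tmag :: "('x, 'y, 'k::comm_ring_1) mpoly \<Rightarrow> 'x btree \<Rightarrow> ('x, 'y, 'k) mpoly" where
  "tmag s Hole = s"
| "tmag s (Lf x) = Poly_Mapping.single (0, MLf x) 1"
| "tmag s (Nd l r) = mmul (tmag s l) (tmag s r)"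

lemma mev_mono: "mev (Poly_Mapping.single (0, t) 1) = mtev t"
  unfolding mev_single by simp

lemma mev_tmag: "mev (tmag s t) = tev (mev s) t"
  by (induction t) (simp_all add: mev_mono mev_mmul del: single_one)

definition mbrk :: "'x::linorder list \<Rightarrow> ('x, 'y, 'k::comm_ring_1) mpoly" where
  "mbrk w = tmag 0 (std_tree w)"

lemma mev_mbrk: "mev (mbrk w) = brk w"
  by (simp add: mbrk_def brk_def mev_tmag)

lemma mbrk_single: "mbrk [x] = Poly_Mapping.single (0, MLf x) 1"
  by (simp add: mbrk_def std_tree_single)

lemma mbrk_append:
  assumes "std_tree (u @ v) = Nd (std_tree u) (std_tree v)"
  shows "mbrk (u @ v) = mmul (mbrk u) (mbrk v)"
  by (simp add: mbrk_def assms)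

lemma mideal_mY: "p \<in> mideal G \<Longrightarrow> mY r p \<in> mideal G"
proof (induction r rule: poly_mapping_add_induct)
  case (single b c)
  then show ?case using mideal.scale[of p G c b] by (simp add: mscale_eq_mY)
qed (simp_all add: mideal.zero M.scale_left_distrib mideal.add)

lemma mideal_subspace: "M.subspace (mideal G)"
  by (simp add: M.subspace_def mideal.zero mideal.add mideal_mY)

lemma mideal_minus: "p \<in> mideal G \<Longrightarrow> - p \<in> mideal G"
  using M.subspace_neg[OF mideal_subspace] by blast

text \<open>Polarization of the relations \<open>[p, p] = 0\<close> at \<open>p + q\<close>.\<close>

lemma mideal_anticomm: "mmul p q + mmul q p \<in> mideal (LieRels R S)"
proof -
  have sq: "mmul r r \<in> mideal (LieRels R S)" for r
    by (rule mideal.gen) (auto simp: LieRels_def)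
  have "mmul p q + mmul q p = mmul (p + q) (p + q) - mmul p p - mmul q q"
    by (simp add: mmul_add_left mmul_add_right)
  then show ?thesis
    using M.subspace_diff[OF mideal_subspace] sq by metis
qed

lemma mideal_jacobi:
  "mmul (mmul p q) r + mmul (mmul q r) p + mmul (mmul r p) q \<in> mideal (LieRels R S)"
  by (rule mideal.gen) (unfold LieRels_def, blast)

text \<open>Evaluating a tree at an element of an ideal stays in the ideal provided that the element
  is actually inserted somewhere; special bracketings always have the hole.\<close>

fun has_hole :: "'x btree \<Rightarrow> bool" where
  "has_hole Hole = True"
| "has_hole (Lf x) = False"
| "has_hole (Nd l r) = (has_hole l \<or> has_hole r)"

lemma mideal_tmag: "s \<in> mideal G \<Longrightarrow> has_hole t \<Longrightarrow> tmag s t \<in> mideal G"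
  by (induction t) (auto intro: mideal.intros)

lemma has_hole_foldl: "has_hole t \<Longrightarrow> has_hole (foldl Nd t ts)"
  by (induction ts arbitrary: t) auto

lemma has_hole_repl: "(\<And>w. has_hole (F w)) \<Longrightarrow> has_hole (repl p L F off t)"
  by (induction p L F off t rule: repl.induct) (auto simp: Let_def)

lemma has_hole_special_tree: "has_hole (special_tree a u b)"
  unfolding special_tree_def by (rule has_hole_repl) (simp add: has_hole_foldl)

lemma mmul_span_left:
  assumes "p \<in> M.span (B \<union> mideal G)" "\<And>x. x \<in> B \<Longrightarrow> mmul x q \<in> M.span (C \<union> mideal G)"
  shows "mmul p q \<in> M.span (C \<union> mideal G)"
  using assms(1)
proof (induction rule: M.span_induct_alt)
  case (step c x y)
  have "mmul x q \<in> M.span (C \<union> mideal G)"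
  proof (cases "x \<in> B")
    case False
    then have "mmul x q \<in> C \<union> mideal G" using step(1) by (simp add: mideal.mulr)
    then show ?thesis by (rule M.span_base)
  qed (rule assms(2))
  then show ?case using step by (simp add: mmul_add_left mmul_mY_left M.span_add M.span_scale)
qed (simp add: M.span_zero)

lemma mmul_span_right:
  assumes "p \<in> M.span (B \<union> mideal G)" "\<And>x. x \<in> B \<Longrightarrow> mmul q x \<in> M.span (C \<union> mideal G)"
  shows "mmul q p \<in> M.span (C \<union> mideal G)"
  using assms(1)
proof (induction rule: M.span_induct_alt)
  case (step c x y)
  have "mmul q x \<in> M.span (C \<union> mideal G)"
  proof (cases "x \<in> B")
    case False
    then have "mmul q x \<in> C \<union> mideal G" using step(1) by (simp add: mideal.mull)
    then show ?thesis by (rule M.span_base)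
  qed (rule assms(2))
  then show ?case using step by (simp add: mmul_add_right mmul_mY_right M.span_add M.span_scale)
qed (simp add: M.span_zero)

lemma mmul_swap_span:
  assumes "mmul p q \<in> M.span (C \<union> mideal (LieRels R S))"
  shows "mmul q p \<in> M.span (C \<union> mideal (LieRels R S))"
proof -
  have "mmul p q + mmul q p \<in> M.span (C \<union> mideal (LieRels R S))"
    by (rule M.span_base) (use mideal_anticomm in blast)
  from M.span_diff[OF this assms] show ?thesis by simp
qed

lemma mmul_jacobi_span:
  assumes "mmul (mmul q r) p \<in> M.span (C \<union> mideal (LieRels R S))"
    and "mmul (mmul r p) q \<in> M.span (C \<union> mideal (LieRels R S))"
  shows "mmul (mmul p q) r \<in> M.span (C \<union> mideal (LieRels R S))"
proof -
  have "mmul (mmul p q) r + mmul (mmul q r) p + mmul (mmul r p) q \<in> M.span (C \<union> mideal (LieRels R S))"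
    by (rule M.span_base) (use mideal_jacobi in blast)
  from M.span_diff[OF M.span_diff[OF this assms(2)] assms(1)] show ?thesis by simp
qed

section \<open>Hall's rewriting into standard bracketings\<close>

definition hallB :: "'x::linorder set \<Rightarrow> nat \<Rightarrow> 'x list \<Rightarrow> ('x, 'y, 'k::comm_ring_1) mpoly set" where
  "hallB X n v = mbrk ` {w. ALSW w \<and> length w = n \<and> set w \<subseteq> X \<and> lexgt w v}"

lemma hallB_mono: "lexgt z v \<Longrightarrow> hallB X n z \<subseteq> hallB X n v"
  unfolding hallB_def by (rule image_mono) (use lexgt_trans[of _ z v] in auto)

text \<open>Jacobi's identity on \<open>[[p, q], v]\<close> leaves brackets of two words of the same total length that
  are both greater than \<open>v\<close>; over finitely many letters only finitely many words of bounded length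
  exceed \<open>v\<close>, so this terminates.\<close>

lemma mmul_mbrk_span:
  fixes R :: "(('y \<Rightarrow>\<^sub>0 nat) \<Rightarrow>\<^sub>0 'k::comm_ring_1) set" and S :: "('x::linorder, 'y, 'k) kpoly set"
  assumes X: "finite X"
  shows "ALSW u \<Longrightarrow> ALSW v \<Longrightarrow> lexgt u v \<Longrightarrow> length u + length v = n \<Longrightarrow> set u \<subseteq> X \<Longrightarrow> set v \<subseteq> X
    \<Longrightarrow> mmul (mbrk u) (mbrk v) \<in> M.span (hallB X n v \<union> mideal (LieRels R S))"
proof (induction n arbitrary: u v rule: less_induct)
  case (less n)
  \<comment> \<open>The size of \<open>?D v\<close> is the inner induction measure. When both
    factors of a new product exceed \<open>v\<close>, its smaller factor \<open>y\<close> takes the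
    place of \<open>v\<close>; it belongs to \<open>?D v\<close> but not to
    \<open>?D y\<close>.\<close>
  let ?D = "\<lambda>v. {w. set w \<subseteq> X \<and> length w \<le> n \<and> lexgt w v}"
  have fin: "finite (?D v)" for v
    by (rule finite_subset[OF _ finite_lists_length_le[OF X, of n]]) blast
  show ?case
    using less.prems
  proof (induction "card (?D v)" arbitrary: u v rule: less_induct)
    case inner: less
    note prems = inner.prems
    have pair: "mmul (mbrk x) (mbrk y) \<in> M.span (hallB X n v \<union> mideal (LieRels R S))"
      if xy: "ALSW x" "ALSW y" "length x + length y = n" "set x \<subseteq> X" "set y \<subseteq> X" "lexgt x v" "lexgt y v" for x y
    proof -
      have step: "mmul (mbrk x) (mbrk y) \<in> M.span (hallB X n v \<union> mideal (LieRels R S))"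
        if xy: "ALSW x" "ALSW y" "lexgt x y" "length x + length y = n" "set x \<subseteq> X" "set y \<subseteq> X" "lexgt y v" for x y
      proof -
        have "?D y \<subseteq> ?D v" using lexgt_trans[OF _ xy(7)] by auto
        moreover have "y \<in> ?D v" using xy(4,6,7) by simp
        moreover have "y \<notin> ?D y" by simp
        ultimately have "?D y \<subset> ?D v" by blast
        then have "card (?D y) < card (?D v)" by (rule psubset_card_mono[OF fin])
        from inner.hyps[OF this xy(1-6)] show ?thesis
          by (rule subsetD[OF M.span_mono[OF Un_mono[OF hallB_mono[OF xy(7)] order_refl]]])
      qed
      consider "lexgt x y" | "lexgt y x" | "x = y" using lexgt_total by metis
      then show ?thesis
      proof cases
        case 1
        then show ?thesis using step xy by simp
      next
        case 2
        then have "mmul (mbrk y) (mbrk x) \<in> M.span (hallB X n v \<union> mideal (LieRels R S))"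
          using step[of y x] xy by simp
        then show ?thesis by (rule mmul_swap_span)
      next
        case 3
        have "mmul (mbrk x) (mbrk x) \<in> mideal (LieRels R S)"
          by (rule mideal.gen) (auto simp: LieRels_def)
        then show ?thesis unfolding 3 by (intro M.span_base) blast
      qed
    qed
    show ?case
    proof (cases "2 \<le> length u \<and> lexgt (drop (std_cut u) u) v")
      \<comment> \<open>Here \<open>u @ v\<close> is cut exactly at \<open>v\<close>, so the product
        is itself a standard bracketing.\<close>
      case False
      have cut: "std_cut (u @ v) = length u"
        by (rule std_cut_append[OF prems(1-3)]) (use False in simp)
      have nn: "u \<noteq> []" "v \<noteq> []" using prems ALSW_not_Nil by auto
      have "2 \<le> length (u @ v)" using nn by (cases u; cases v) auto
      from std_tree_Nd[OF this] have "(mbrk (u @ v) :: ('x, 'y, 'k) mpoly) = mmul (mbrk u) (mbrk v)"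
        by (intro mbrk_append) (simp add: cut)
      moreover have A: "ALSW (u @ v)" by (rule ALSW_append[OF prems(1-3)])
      moreover have "lexgt (u @ v) v" by (rule ALSW_gt_suffix[OF A nn])
      ultimately have "(mmul (mbrk u) (mbrk v) :: ('x, 'y, 'k) mpoly) \<in> hallB X n v"
        unfolding hallB_def by (intro image_eqI[of _ _ "u @ v"]) (use prems(4-6) in simp_all)
      then show ?thesis by (intro M.span_base) simp
    next
      case True
      define p q where "p = take (std_cut u) u" and "q = drop (std_cut u) u"
      have l: "2 \<le> length u" and qv: "lexgt q v" using True by (auto simp: q_def)
      have u: "u = p @ q" by (simp add: p_def q_def)
      have A: "ALSW p" "ALSW q"
        using ALSW_std_left[OF prems(1) l] std_cut(3)[OF l] by (simp_all add: p_def q_def)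
      have mu: "(mbrk u :: ('x, 'y, 'k) mpoly) = mmul (mbrk p) (mbrk q)"
        using mbrk_append[of p q] std_tree_Nd[OF l]
        unfolding p_def[symmetric] q_def[symmetric] u[symmetric] by simp
      have pn: "p \<noteq> []" "q \<noteq> []" using A ALSW_not_Nil by auto
      have pv: "lexgt p v" using lexgt_shorten[of p q v] prems(3) u by simp
      have sets: "set p \<subseteq> X" "set q \<subseteq> X" and len: "length p + length q + length v = n"
        using prems(4,5) u by auto
      have lt: "length q + length v < n" "length p + length v < n" using len pn by auto
      \<comment> \<open>This bracket has smaller total length, so the outer induction turns it into
        words above \<open>v\<close> of that length. Each of them, paired with \<open>p\<close>, has
        total length \<open>n\<close> again and both factors above \<open>v\<close>, which is what
        \<open>pair\<close> handles.\<close>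
      have "mmul (mbrk q) (mbrk v) \<in> M.span (hallB X (length q + length v) v \<union> mideal (LieRels R S))"
        by (rule less.IH[OF lt(1) A(2) prems(2) qv refl sets(2) prems(6)])
      then have 1: "mmul (mmul (mbrk q) (mbrk v)) (mbrk p) \<in> M.span (hallB X n v \<union> mideal (LieRels R S))"
        by (rule mmul_span_left)
          (use pair[OF _ A(1) _ _ sets(1) _ pv] len in \<open>auto simp: hallB_def\<close>)
      have "mmul (mbrk p) (mbrk v) \<in> M.span (hallB X (length p + length v) v \<union> mideal (LieRels R S))"
        by (rule less.IH[OF lt(2) A(1) prems(2) pv refl sets(1) prems(6)])
      then have "mmul (mbrk v) (mbrk p) \<in> M.span (hallB X (length p + length v) v \<union> mideal (LieRels R S))"
        by (rule mmul_swap_span)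
      then have 2: "mmul (mmul (mbrk v) (mbrk p)) (mbrk q) \<in> M.span (hallB X n v \<union> mideal (LieRels R S))"
        by (rule mmul_span_left)
          (use pair[OF _ A(2) _ _ sets(2) _ qv] len in \<open>auto simp: hallB_def\<close>)
      show ?thesis unfolding mu by (rule mmul_jacobi_span[OF 1 2])
    qed
  qed
qed

lemma mbrk_spans:
  fixes R :: "(('y \<Rightarrow>\<^sub>0 nat) \<Rightarrow>\<^sub>0 'k::comm_ring_1) set" and S :: "('x::linorder, 'y, 'k) kpoly set"
  shows "p \<in> M.span (mbrk ` {w. ALSW w} \<union> mideal (LieRels R S))" (is "_ \<in> M.span (?B \<union> ?J)")
proof -
  have prod: "mmul (mbrk u) (mbrk v) \<in> M.span (?B \<union> ?J)" if uv: "ALSW u" "ALSW v" for u v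
  proof -
    have gt: "mmul (mbrk u) (mbrk v) \<in> M.span (?B \<union> ?J)" if uv: "ALSW u" "ALSW v" "lexgt u v" for u v
    proof -
      \<comment> \<open>Only the letters of \<open>u\<close> and \<open>v\<close> matter, which
        supplies the finite alphabet needed for termination.\<close>
      let ?X = "set u \<union> set v" and ?n = "length u + length v"
      have "mmul (mbrk u) (mbrk v) \<in> M.span (hallB ?X ?n v \<union> ?J)"
        by (rule mmul_mbrk_span) (use uv in auto)
      moreover have "hallB ?X ?n v \<subseteq> ?B" by (auto simp: hallB_def)
      ultimately show ?thesis using M.span_mono[OF Un_mono[OF _ order_refl]] by blast
    qed
    consider "lexgt u v" | "lexgt v u" | "u = v" using lexgt_total by metis
    then show ?thesis
    proof cases
      case 2
      then show ?thesis using gt[of v u] uv mmul_swap_span by blast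
    next
      case 3
      have "mmul (mbrk u) (mbrk u) \<in> ?J"
        by (rule mideal.gen) (auto simp: LieRels_def)
      then show ?thesis unfolding 3 by (intro M.span_base) blast
    qed (use gt uv in blast)
  qed
  have mono: "Poly_Mapping.single (0, t) 1 \<in> M.span (?B \<union> ?J)" for t
  proof (induction t)
    case (MLf x)
    have "mbrk [x] \<in> ?B" by (rule imageI) simp
    then show ?case unfolding mbrk_single by (intro M.span_base) blast
  next
    case (MNd l r)
    have eq: "Poly_Mapping.single (0, MNd l r) 1
        = mmul (Poly_Mapping.single (0, l) 1) (Poly_Mapping.single (0, r) 1)"
      by (simp add: mmul_single)
    have "mmul x (Poly_Mapping.single (0, r) 1) \<in> M.span (?B \<union> ?J)" if "x \<in> ?B" for x
      using that prod by (intro mmul_span_right[OF MNd(2)]) auto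
    then show ?case unfolding eq by (rule mmul_span_left[OF MNd(1)])
  qed
  show ?thesis
  proof (induction p rule: poly_mapping_add_induct)
    case (single m c)
    have "Poly_Mapping.single m c = mY (Poly_Mapping.single (fst m) c) (Poly_Mapping.single (0, snd m) 1)"
      by (simp add: mY_single del: single_one)
    then show ?case using M.span_scale mono by metis
  qed (simp_all add: M.span_zero M.span_add)
qed

section \<open>The Lie ideal and the associative ideal\<close>

lemma mev_mideal:
  assumes "p \<in> mideal (LieRels R S)"
  shows "mev p \<in> aideal (URels R S)"
  using assms
proof (induction rule: mideal.induct)
  case (gen g)
  then consider q where "g = mmul q q"
    | p q r where "g = mmul (mmul p q) r + mmul (mmul q r) p + mmul (mmul r p) q"
    | r m where "r \<in> R" "g = mY r m" | "mev g \<in> S"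
    by (auto simp: LieRels_def)
  then show ?case
  proof cases
    case 1
    then show ?thesis by (simp add: mev_mmul bracket_self aideal.zero)
  next
    case 2
    then show ?thesis by (simp add: mev_mmul mev_add bracket_jacobi aideal.zero)
  next
    case 3
    then have "mev g = pmul (embedY r) (mev m)" by (simp add: mev_mY smul_def)
    moreover have "embedY r \<in> aideal (URels R S)"
      using 3 by (intro aideal.gen) (simp add: URels_def)
    ultimately show ?thesis by (simp add: aideal.mulr)
  next
    case 4
    then show ?thesis by (intro aideal.gen) (simp add: URels_def)
  qed
next
  case (scale p c b)
  then show ?case by (simp add: mscale_eq_mY mev_mY smul_def aideal.mull)
next
  case (mulr p q)
  \<comment> \<open>\<open>aideal\<close> is generated by sums and products only; the subtraction in
    the commutator is rewritten as multiplication by the scalar \<open>- 1\<close>.\<close>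
  have "bracket (mev p) (mev q) = pmul (mev p) (mev q) + pmul (embedY (- 1)) (pmul (mev q) (mev p))"
    by (simp add: bracket_def smul_def[symmetric])
  then show ?case using mulr by (simp add: mev_mmul aideal.add aideal.mulr aideal.mull)
next
  case (mull p q)
  have "bracket (mev q) (mev p) = pmul (mev q) (mev p) + pmul (embedY (- 1)) (pmul (mev p) (mev q))"
    by (simp add: bracket_def smul_def[symmetric])
  then show ?case using mull by (simp add: mev_mmul aideal.add aideal.mulr aideal.mull)
qed (simp_all add: aideal.zero aideal.add mev_add)

lemma mideal_mono: "G \<subseteq> H \<Longrightarrow> mideal G \<subseteq> mideal H"
proof
  fix p assume GH: "G \<subseteq> H" and "p \<in> mideal G"
  from this(2) show "p \<in> mideal H"
    by (induction rule: mideal.induct) (use GH in \<open>auto intro: mideal.intros\<close>)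
qed

text \<open>Together with \<open>mev_mideal\<close>, this shows that \<open>mev\<close> kills every
  consequence of the Lie axioms alone.\<close>

lemma aideal_URels_empty: "p \<in> aideal (URels {} {}) \<Longrightarrow> p = 0"
  by (induction rule: aideal.induct) (auto simp: URels_def)

text \<open>The elements of \<open>S\<close> enter the Lie relations through their preimages under
  \<open>mev\<close>; this provides such preimages.\<close>

lemma LieKY_lift:
  assumes "p \<in> LieKY"
  obtains m where "mev m = p"
proof -
  have "\<exists>m. mev m = p" using assms
  proof (induction rule: LieKY.induct)
    case (gen x)
    show ?case using mev_mono[of "MLf x"] by (intro exI) simp
  next
    case (add p q)
    then show ?case using mev_add by metis
  next
    case (smul p c)
    then obtain m where "mev m = p" by blast
    then have "mev (mY (cf c []) m) = pmul c p" using smul.hyps by (simp add: mev_mY pmul_isY)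
    then show ?case by blast
  next
    case (brk p q)
    then show ?case using mev_mmul by metis
  qed
  then show ?thesis using that by blast
qed

section \<open>Reduction to irreducible words and injectivity\<close>

context monic_GSB begin

text \<open>For reducible \<open>u\<close>, inserting a lift of \<open>s\<close> into the special
  bracketing of \<open>u\<close> gives an element of the Lie ideal whose image has leading word
  \<open>u\<close> with coefficient \<open>1\<close>. Expanded in standard bracketings, it expresses
  \<open>[u]\<close> by those of smaller words, to which the induction applies.\<close>

lemma mbrk_reduce:
  fixes R :: "(('y \<Rightarrow>\<^sub>0 nat) \<Rightarrow>\<^sub>0 'k) set"
  assumes L: "S \<subseteq> LieKY"
  shows "ALSW u \<Longrightarrow> mbrk u \<in> M.span (mbrk ` ({w. ALSW w} - Red) \<union> mideal (LieRels R S))"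
    (is "_ \<Longrightarrow> _ \<in> M.span (?B \<union> ?J)")
proof (induction u rule: wf_induct_rule[OF wf_deglexX])
  case (1 u)
  show ?case
  proof (cases "u \<in> Red")
    case False
    then have "mbrk u \<in> ?B" using 1(2) by blast
    then show ?thesis by (intro M.span_base) blast
  next
    case True
    then obtain a s b where s: "s \<in> S" "u = a @ LX s @ b" by (auto simp: Red_def)
    obtain m where m: "mev m = s" using L s(1) LieKY_lift by blast
    define z where "z = tmag m (special_tree a (LX s) b)"
    have "m \<in> ?J" by (rule mideal.gen) (use m s in \<open>simp add: LieRels_def\<close>)
    then have zJ: "z \<in> ?J" unfolding z_def using has_hole_special_tree by (rule mideal_tmag)
    have mz: "mev z = nsw a s b" by (simp add: z_def mev_tmag m nsw_def)
    have lz: "lead (mev z) u" unfolding mz s(2) by (rule lead_nsw) (use s 1(2) in simp_all)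
    \<comment> \<open>The expansion uses the Lie axioms alone: \<open>mev\<close> sends their ideal
      to \<open>0\<close>, so the combination has exactly the image of \<open>z\<close>. A remainder
      involving \<open>R\<close> or \<open>S\<close> could disturb the leading coefficient.\<close>
    let ?Lie = "mideal (LieRels {} {})"
    have "z \<in> M.span (mbrk ` {w. ALSW w} \<union> ?Lie)" by (rule mbrk_spans)
    then obtain x j where zx: "z = x + j" and x: "x \<in> M.span (mbrk ` {w. ALSW w})" and "j \<in> M.span ?Lie"
      unfolding M.span_Un by blast
    then have j: "j \<in> ?Lie" using mideal_subspace M.span_eq_iff by metis
    have mj: "mev j = 0" by (rule aideal_URels_empty[OF mev_mideal[OF j]])
    have "LieRels {} {} \<subseteq> LieRels R S" unfolding LieRels_def by blast
    then have jJ: "j \<in> ?J" using j mideal_mono by blast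
    from x obtain F c where F: "finite F" "F \<subseteq> {w. ALSW w}" "x = (\<Sum>w\<in>F. mY (c w) (mbrk w))"
      by (rule M.span_image_explicit)
    have mx: "mev z = (\<Sum>w\<in>F. smul (c w) (brk w))"
      by (simp add: zx mev_add mj F(3) mev.sum mev_mY mev_mbrk)
    have cz: "cf (mev z) u = 1" "\<And>v. v \<noteq> u \<Longrightarrow> cf (mev z) v \<noteq> 0 \<Longrightarrow> deglexX u v"
      using lz by (auto simp: lead_iff_cf)
    have "\<exists>w\<in>F. c w \<notin> {0}"
    proof (rule ccontr)
      assume "\<not> ?thesis"
      then have "mev z = 0" unfolding mx by simp
      then show False using cz(1) by simp
    qed
    then obtain w1 where w1: "w1 \<in> F" "c w1 \<notin> {0}" by blast
    \<comment> \<open>The zero ideal turns \<open>triangular_top\<close> into the usual statement on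
      leading terms, which yields \<open>c u = 1\<close>.\<close>
    have I: "is_ideal {0 :: ('y \<Rightarrow>\<^sub>0 nat) \<Rightarrow>\<^sub>0 'k}" by (simp add: is_ideal_def)
    have lb: "\<And>w. w \<in> F \<Longrightarrow> lead (brk w) w" using F(2) lead_brk by blast
    obtain w0 where w0: "w0 \<in> F" "\<And>v. v \<in> F \<Longrightarrow> c v \<notin> {0} \<Longrightarrow> v \<noteq> w0 \<Longrightarrow> deglexX w0 v"
      "cf (mev z) w0 - c w0 \<in> {0}" "cf (mev z) w0 \<notin> {0}" "\<And>v. deglexX v w0 \<Longrightarrow> cf (mev z) v \<in> {0}"
      by (rule triangular_top[where \<alpha> = c, OF F(1) lb I w1]) (unfold mx[symmetric], blast+)
    have "w0 = u"
    proof (rule ccontr)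
      assume "w0 \<noteq> u"
      then have "deglexX u w0" using cz(2) w0(4) by simp
      then show False using w0(5) cz(1) by simp
    qed
    then have cu: "c u = 1" "u \<in> F" using w0(1,3) cz(1) by simp_all
    have "z = mbrk u + (\<Sum>w\<in>F - {u}. mY (c w) (mbrk w)) + j"
      using zx F(1,3) cu by (simp add: sum.remove)
    then have eq: "mbrk u = z - (\<Sum>w\<in>F - {u}. mY (c w) (mbrk w)) - j" by simp
    have "mY (c w) (mbrk w) \<in> M.span (?B \<union> ?J)" if w: "w \<in> F - {u}" for w
    proof (cases "c w = 0")
      case True
      then show ?thesis by (simp add: M.span_zero)
    next
      case False
      then have "deglexX u w" using w0(2)[of w] w \<open>w0 = u\<close> by simp
      moreover have "ALSW w" using w F(2) by blast
      ultimately have "mbrk w \<in> M.span (?B \<union> ?J)" using 1(1)[of w] by simp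
      then show ?thesis by (rule M.span_scale)
    qed
    then have "(\<Sum>w\<in>F - {u}. mY (c w) (mbrk w)) \<in> M.span (?B \<union> ?J)" by (rule M.span_sum)
    moreover have "z \<in> M.span (?B \<union> ?J)" "j \<in> M.span (?B \<union> ?J)"
      using zJ jJ by (simp_all add: M.span_base)
    ultimately show ?thesis unfolding eq by (intro M.span_diff)
  qed
qed

lemma mev_injective:
  fixes R :: "(('y \<Rightarrow>\<^sub>0 nat) \<Rightarrow>\<^sub>0 'k) set"
  assumes L: "S \<subseteq> LieKY" and m: "mev m \<in> aideal (URels R S)"
  shows "m \<in> mideal (LieRels R S)" (is "_ \<in> ?J")
proof -
  let ?B = "mbrk ` ({w. ALSW w} - Red)"
  have "mbrk ` {w. ALSW w} \<union> ?J \<subseteq> M.span (?B \<union> ?J)"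
    using mbrk_reduce[OF L] M.span_superset by blast
  then have "M.span (mbrk ` {w. ALSW w} \<union> ?J) \<subseteq> M.span (?B \<union> ?J)"
    by (rule M.span_minimal) (rule M.subspace_span)
  then have "m \<in> M.span (?B \<union> ?J)" using mbrk_spans by blast
  then obtain x j where mx: "m = x + j" and x: "x \<in> M.span ?B" and "j \<in> M.span ?J"
    unfolding M.span_Un by blast
  then have j: "j \<in> ?J" using mideal_subspace M.span_eq_iff by metis
  from x obtain F c where F: "finite F" "F \<subseteq> {w. ALSW w} - Red" "x = (\<Sum>w\<in>F. mY (c w) (mbrk w))"
    by (rule M.span_image_explicit)
  have "- j \<in> ?J" using j by (rule mideal_minus)
  from aideal.add[OF m mev_mideal[OF this]]
  have "mev x \<in> aideal (URels R S)" by (simp add: mx mev_add mev.neg)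
  moreover have "mev x = (\<Sum>w\<in>F. smul (c w) (brk w))"
    by (simp add: F(3) mev.sum mev_mY mev_mbrk)
  ultimately have f: "(\<Sum>w\<in>F. smul (c w) (brk w)) \<in> aideal (URels R S)" by simp
  \<comment> \<open>The annihilator of the quotient by the Lie ideal. It contains \<open>R\<close>
    by the defining relations, and a coefficient in it puts its term \<open>c w [w]\<close> into the
    Lie ideal, which is all that the conclusion requires.\<close>
  define I where "I = {r. \<forall>p. mY r p \<in> ?J}"
  have I: "is_ideal I"
    unfolding is_ideal_def I_def
    by (auto simp: mideal.zero M.scale_left_distrib mideal.add M.scale_scale[symmetric] mideal_mY
        simp del: M.scale_scale)
  have RI: "R \<subseteq> I"
    unfolding I_def by (auto intro!: mideal.gen simp: LieRels_def)
  have "c u \<in> I" if "u \<in> F" for u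
    by (rule irreducible_independent[OF I RI F(1) _ _ f that]) (use F(2) in auto)
  then have "x \<in> ?J"
    unfolding F(3) by (intro M.subspace_sum[OF mideal_subspace]) (simp add: I_def)
  then show ?thesis using j mx mideal.add by blast
qed

end

theorem theorem4p5:
  fixes S :: "('x::wellorder, 'y::wellorder, 'k::field) kpoly set"
    and R :: "(('y \<Rightarrow>\<^sub>0 nat) \<Rightarrow>\<^sub>0 'k) set"
  assumes "S \<subseteq> LieKY"
    and "GSB S"
    and "\<forall>s\<in>S. kY_monic s"
  shows "\<forall>m :: ('x, 'y, 'k) mpoly.
           mev m \<in> aideal (URels R S) \<longrightarrow> m \<in> mideal (LieRels R S)"
proof -
  interpret monic_GSB S by unfold_locales (use assms in auto)
  show ?thesis using mev_injective[OF assms(1)] by blast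
qed

end
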